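(* The set $\mathrm{Ob}(\mathbb Z_2^n\mathtt{Pts})=\{\mathbb R^{0|\underline m}\,:\,\underline m\in\mathbb N^{N}\}$ of $\mathbb Z_2^n$-points is a generating set of the category $\mathbb Z_2^n\mathtt{Man}$ of $\mathbb Z_2^n$-manifolds. That is, for any two distinct morphisms $\phi\neq\psi\colon M\to N'$ of $\mathbb Z_2^n$-manifolds there exist a $\mathbb Z_2^n$-point $\mathbb R^{0|\underline m}$ and a morphism of $\mathbb Z_2^n$-manifolds $s\colon\mathbb R^{0|\underline m}\to M$ such that $\phi\circ s\neq\psi\circ s$.
   Context: Fix $n\in\mathbb N=\{0,1,2,\dots\}$. Let $\mathbb Z_2^n=(\mathbb Z/2)^n$ with its standard scalar product $\langle-,-\rangle\in\mathbb Z_2$, $N=2^n-1$, and let $\gamma_1,\dots,\gamma_N$ be the nonzero elements of $\mathbb Z_2^n$ in lexicographic order. A $\mathbb Z_2^n$-graded algebra is $\mathbb Z_2^n$-commutative if $ab=(-1)^{\langle\deg a,\deg b\rangle}ba$ for homogeneous $a,b$. For $p\in\mathbb N$, $\underline q=(q_1,\dots,q_N)\in\mathbb N^N$, let $\mathbb R^{p|\underline q}=(\mathbb R^p,C^\infty_{\mathbb R^p}[[\xi]])$ be the space $\mathbb R^p$ with the sheaf of formal power series, with smooth coefficients, in formal variables $\xi^A$ ($q_i$ of them of degree $\gamma_i$) subject to $\xi^A\xi^B=(-1)^{\langle\deg\xi^A,\deg\xi^B\rangle}\xi^B\xi^A$. A locally $\mathbb Z_2^n$-ringed space is a pair $(|X|,\mathcal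 O_X)$ with $|X|$ a second-countable Hausdorff space and $\mathcal O_X$ a sheaf of $\mathbb Z_2^n$-graded $\mathbb Z_2^n$-commutative associative unital $\mathbb R$-algebras with local stalks. A $\mathbb Z_2^n$-manifold of dimension $p|\underline q$ is a locally $\mathbb Z_2^n$-ringed space $M=(|M|,\mathcal O_M)$ locally isomorphic to $\mathbb R^{p|\underline q}$. A morphism $\phi=(|\phi|,\phi^* )\colon M\to N'$ consists of a continuous map $|\phi|\colon|M|\to|N'|$ and a morphism $\phi^*\colon\mathcal O_{N'}\to|\phi|_*\mathcal O_M$ of sheaves of $\mathbb Z_2^n$-graded unital $\mathbb R$-algebras. A $\mathbb Z_2^n$-point is a $\mathbb Z_2^n$-manifold $\mathbb R^{0|\underline m}$; $\mathbb Z_2^n\mathtt{Pts}$ is the full subcategory of $\mathbb Z_2^n\mathtt{Man}$ on these objects. *)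

theory Defs
  imports "HOL-Analysis.Analysis" "HOL-Algebra.Algebraic_Closure_Type" "HOL-Library.Z2"
begin

section \<open>The grading group\<close>

text \<open>
  Elements of \<open>(\<int>/2)\<^sup>n\<close> are lists of length \<open>n\<close> over the two-element field \<^typ>\<open>bit\<close>; lists rather
  than finite types are used as indices because \<open>n = 0\<close> is allowed.
\<close>

definition zn :: "nat \<Rightarrow> bit list set"
  where "zn n = {v. length v = n}"

definition zn_add :: "bit list \<Rightarrow> bit list \<Rightarrow> bit list"
  where "zn_add v w = map2 (+) v w"

definition zn_pair :: "bit list \<Rightarrow> bit list \<Rightarrow> bit"
  where "zn_pair v w = sum_list (map2 (*) v w)"

definition zn_sign :: "bit \<Rightarrow> real"
  where "zn_sign b = (if b = 0 then 1 else -1)"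

text \<open>
  \<^const>\<open>product_lists\<close> enumerates the words over \<open>0 < 1\<close> lexicographically; see
  \<open>sorted_zn_gammas\<close> and \<open>set_zn_gammas\<close> below.  The list is indexed from \<open>0\<close>, so
  \<open>\<gamma>\<^sub>i\<close> is entry \<open>i - 1\<close>.
\<close>

definition zn_gammas :: "nat \<Rightarrow> bit list list"
  where "zn_gammas n = filter (\<lambda>v. v \<noteq> replicate n 0) (product_lists (replicate n [0, 1]))"

lemma set_zn_gammas: "set (zn_gammas n) = zn n - {replicate n 0}"
proof -
  have "list_all2 (\<lambda>x ys. x \<in> set ys) v (replicate n [0, 1 :: bit]) \<longleftrightarrow> length v = n" for v
    by (auto simp: list_all2_conv_all_nth)
  then show ?thesis
    by (auto simp: zn_gammas_def zn_def product_lists_set)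
qed

lemma sorted_zn_gammas: "sorted_wrt (\<lambda>v w. (v, w) \<in> lexord {(0, 1)}) (zn_gammas n)"
proof -
  have "sorted_wrt (\<lambda>v w. (v, w) \<in> lexord {(0, 1)}) (product_lists (replicate n [0, 1 :: bit]))"
    by (induction n) (auto simp: sorted_wrt_append sorted_wrt_map)
  then show ?thesis
    by (simp add: zn_gammas_def sorted_wrt_filter)
qed

lemma length_zn_gammas: "length (zn_gammas n) = 2 ^ n - 1"
proof -
  have irrefl: "(v, v) \<notin> lexord {(0 :: bit, 1)}" for v
    by (induction v) auto
  have "sorted_wrt (\<noteq>) (zn_gammas n)"
    by (rule sorted_wrt_mono_rel[OF _ sorted_zn_gammas]) (use irrefl in auto)
  then have "distinct (zn_gammas n)"
    unfolding distinct_conv_nth sorted_wrt_iff_nth_less by (metis linorder_neqE_nat)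
  then have "length (zn_gammas n) = card (zn n - {replicate n 0})"
    by (metis distinct_card set_zn_gammas)
  moreover have "card (zn n) = 2 ^ n" "finite (zn n)"
  proof -
    have "UNIV = {0, 1 :: bit}" by auto
    then have "zn n = {xs. set xs \<subseteq> {0, 1} \<and> length xs = n}"
      by (auto simp: zn_def)
    then show "card (zn n) = 2 ^ n" "finite (zn n)"
      using card_lists_length_eq[of "{0, 1 :: bit}" n] finite_lists_length_eq[of "{0, 1 :: bit}" n]
      by (simp_all only: finite.intros simp_thms) (simp add: numeral_2_eq_2)
  qed
  ultimately show ?thesis by (simp add: zn_def)
qed


section \<open>Graded-commutative algebras\<close>

abbreviation real_ring :: "real ring"
  where "real_ring \<equiv> ring_of_type_algebra"

record 's galgebra = "(real, 's) module" +
  hcomp :: "bit list \<Rightarrow> 's set"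

definition zn_algebra :: "nat \<Rightarrow> 's galgebra \<Rightarrow> bool"
  where "zn_algebra n A \<longleftrightarrow>
    ring A \<and> module real_ring A \<and>
    (\<forall>c. \<forall>a \<in> carrier A. \<forall>b \<in> carrier A.
       (c \<odot>\<^bsub>A\<^esub> a) \<otimes>\<^bsub>A\<^esub> b = c \<odot>\<^bsub>A\<^esub> (a \<otimes>\<^bsub>A\<^esub> b) \<and>
       a \<otimes>\<^bsub>A\<^esub> (c \<odot>\<^bsub>A\<^esub> b) = c \<odot>\<^bsub>A\<^esub> (a \<otimes>\<^bsub>A\<^esub> b)) \<and>
    (\<forall>\<gamma> \<in> zn n. submodule (hcomp A \<gamma>) real_ring A) \<and>
    (\<forall>a \<in> carrier A. \<exists>!c. c \<in> (\<Pi>\<^sub>E \<gamma> \<in> zn n. hcomp A \<gamma>) \<and> a = finsum A c (zn n)) \<and>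
    (\<forall>\<gamma> \<in> zn n. \<forall>\<delta> \<in> zn n. \<forall>a \<in> hcomp A \<gamma>. \<forall>b \<in> hcomp A \<delta>.
       a \<otimes>\<^bsub>A\<^esub> b \<in> hcomp A (zn_add \<gamma> \<delta>) \<and>
       a \<otimes>\<^bsub>A\<^esub> b = zn_sign (zn_pair \<gamma> \<delta>) \<odot>\<^bsub>A\<^esub> (b \<otimes>\<^bsub>A\<^esub> a))"

definition zn_algebra_hom :: "nat \<Rightarrow> 's galgebra \<Rightarrow> 't galgebra \<Rightarrow> ('s \<Rightarrow> 't) set"
  where "zn_algebra_hom n A B =
    {h \<in> ring_hom A B.
       (\<forall>c. \<forall>a \<in> carrier A. h (c \<odot>\<^bsub>A\<^esub> a) = c \<odot>\<^bsub>B\<^esub> h a) \<and>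
       (\<forall>\<gamma> \<in> zn n. h ` hcomp A \<gamma> \<subseteq> hcomp B \<gamma>)}"


section \<open>Locally ringed spaces\<close>

text \<open>
  The fields \<open>sec\<close> and \<open>rst\<close> are only meaningful on open sets of \<open>base\<close>; \<open>rst S U V\<close> restricts
  sections from \<open>U\<close> to \<open>V \<subseteq> U\<close>.
\<close>

record ('a, 's) zn_space =
  base :: "'a topology"
  sec :: "'a set \<Rightarrow> 's galgebra"
  rst :: "'a set \<Rightarrow> 'a set \<Rightarrow> 's \<Rightarrow> 's"

definition zn_presheaf :: "nat \<Rightarrow> ('a, 's) zn_space \<Rightarrow> bool"
  where "zn_presheaf n S \<longleftrightarrow>
    (\<forall>U. openin (base S) U \<longrightarrow> zn_algebra n (sec S U)) \<and>
    (\<forall>U V. openin (base S) U \<and> openin (base S) V \<and> V \<subseteq> U \<longrightarrow>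
       rst S U V \<in> zn_algebra_hom n (sec S U) (sec S V)) \<and>
    (\<forall>U. openin (base S) U \<longrightarrow> (\<forall>s \<in> carrier (sec S U). rst S U U s = s)) \<and>
    (\<forall>U V W. openin (base S) U \<and> openin (base S) V \<and> openin (base S) W \<and> W \<subseteq> V \<and> V \<subseteq> U \<longrightarrow>
       (\<forall>s \<in> carrier (sec S U). rst S V W (rst S U V s) = rst S U W s))"

text \<open>
  The grading group is finite, so an element of a graded algebra is the same as the family of its
  homogeneous parts, and gluing arbitrary sections is equivalent to gluing them degree by degree.
\<close>

definition zn_sheaf :: "nat \<Rightarrow> ('a, 's) zn_space \<Rightarrow> bool"
  where "zn_sheaf n S \<longleftrightarrow> zn_presheaf n S \<and>
    (\<forall>\<U>. (\<forall>U \<in> \<U>. openin (base S) U) \<longrightarrow>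
       (\<forall>s \<in> carrier (sec S (\<Union>\<U>)). \<forall>t \<in> carrier (sec S (\<Union>\<U>)).
          (\<forall>U \<in> \<U>. rst S (\<Union>\<U>) U s = rst S (\<Union>\<U>) U t) \<longrightarrow> s = t) \<and>
       (\<forall>c. (\<forall>U \<in> \<U>. c U \<in> carrier (sec S U)) \<and>
            (\<forall>U \<in> \<U>. \<forall>V \<in> \<U>. rst S U (U \<inter> V) (c U) = rst S V (U \<inter> V) (c V)) \<longrightarrow>
          (\<exists>s \<in> carrier (sec S (\<Union>\<U>)). \<forall>U \<in> \<U>. rst S (\<Union>\<U>) U s = c U)))"

definition germ :: "('a, 's) zn_space \<Rightarrow> 'a \<Rightarrow> 'a set \<Rightarrow> 's \<Rightarrow> ('a set \<times> 's) set"
  where "germ S x U s =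
    {(V, t). openin (base S) V \<and> x \<in> V \<and> t \<in> carrier (sec S V) \<and>
       (\<exists>W. openin (base S) W \<and> x \<in> W \<and> W \<subseteq> U \<inter> V \<and> rst S U W s = rst S V W t)}"

definition stalk :: "('a, 's) zn_space \<Rightarrow> 'a \<Rightarrow> ('a set \<times> 's) set ring"
  where "stalk S x =
    \<lparr>carrier = {germ S x U s | U s. openin (base S) U \<and> x \<in> U \<and> s \<in> carrier (sec S U)},
     mult = (\<lambda>g h. \<Union>(U, s) \<in> g. \<Union>(V, t) \<in> h.
       germ S x (U \<inter> V) (rst S U (U \<inter> V) s \<otimes>\<^bsub>sec S (U \<inter> V)\<^esub> rst S V (U \<inter> V) t)),
     one = germ S x (topspace (base S)) \<one>\<^bsub>sec S (topspace (base S))\<^esub>,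
     zero = germ S x (topspace (base S)) \<zero>\<^bsub>sec S (topspace (base S))\<^esub>,
     add = (\<lambda>g h. \<Union>(U, s) \<in> g. \<Union>(V, t) \<in> h.
       germ S x (U \<inter> V) (rst S U (U \<inter> V) s \<oplus>\<^bsub>sec S (U \<inter> V)\<^esub> rst S V (U \<inter> V) t))\<rparr>"

text \<open>
  Stalks are in general not commutative, hence the one-sided ideals: HOL-Algebra's \<^const>\<open>ideal\<close>
  is two-sided.
\<close>

definition left_ideal :: "'r set \<Rightarrow> ('r, 'm) ring_scheme \<Rightarrow> bool"
  where "left_ideal I R \<longleftrightarrow> additive_subgroup I R \<and> (\<forall>a \<in> I. \<forall>x \<in> carrier R. x \<otimes>\<^bsub>R\<^esub> a \<in> I)"

definition maximal_left_ideal :: "'r set \<Rightarrow> ('r, 'm) ring_scheme \<Rightarrow> bool"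
  where "maximal_left_ideal I R \<longleftrightarrow> left_ideal I R \<and> I \<noteq> carrier R \<and>
    (\<forall>J. left_ideal J R \<and> I \<subseteq> J \<longrightarrow> J = I \<or> J = carrier R)"

definition local_ring :: "('r, 'm) ring_scheme \<Rightarrow> bool"
  where "local_ring R \<longleftrightarrow> ring R \<and> (\<exists>!I. maximal_left_ideal I R)"

definition locally_zn_ringed_space :: "nat \<Rightarrow> ('a, 's) zn_space \<Rightarrow> bool"
  where "locally_zn_ringed_space n S \<longleftrightarrow>
    second_countable (base S) \<and> Hausdorff_space (base S) \<and> zn_sheaf n S \<and>
    (\<forall>x \<in> topspace (base S). local_ring (stalk S x))"

definition open_subspace :: "('a, 's) zn_space \<Rightarrow> 'a set \<Rightarrow> ('a, 's) zn_space"
  where "open_subspace S U = S\<lparr>base := subtopology (base S) U\<rparr>"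


section \<open>Morphisms\<close>

text \<open>
  A morphism consists of a map of points and, for every open \<open>V\<close> of the target, a map of sections
  over \<open>V\<close> to sections over the preimage of \<open>V\<close>.  All component functions are required to be
  \<^const>\<open>undefined\<close> off their domains, so that equality of morphisms is equality in HOL.
\<close>

record ('a, 's, 'b, 't) zn_morphism =
  pmap :: "'a \<Rightarrow> 'b"
  pull :: "'b set \<Rightarrow> 't \<Rightarrow> 's"

definition preimg :: "('a, 's) zn_space \<Rightarrow> ('a, 's, 'b, 't) zn_morphism \<Rightarrow> 'b set \<Rightarrow> 'a set"
  where "preimg S \<phi> V = {x \<in> topspace (base S). pmap \<phi> x \<in> V}"

definition zn_hom ::
    "nat \<Rightarrow> ('a, 's) zn_space \<Rightarrow> ('b, 't) zn_space \<Rightarrow> ('a, 's, 'b, 't) zn_morphism set"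
  where "zn_hom n S T = {\<phi>.
    continuous_map (base S) (base T) (pmap \<phi>) \<and>
    pmap \<phi> \<in> extensional (topspace (base S)) \<and>
    (\<forall>V. openin (base T) V \<longrightarrow>
       pull \<phi> V \<in> zn_algebra_hom n (sec T V) (sec S (preimg S \<phi> V)) \<and>
       pull \<phi> V \<in> extensional (carrier (sec T V))) \<and>
    (\<forall>V. \<not> openin (base T) V \<longrightarrow> pull \<phi> V = (\<lambda>_. undefined)) \<and>
    (\<forall>V W. openin (base T) V \<and> openin (base T) W \<and> W \<subseteq> V \<longrightarrow>
       (\<forall>s \<in> carrier (sec T V).
          pull \<phi> W (rst T V W s) = rst S (preimg S \<phi> V) (preimg S \<phi> W) (pull \<phi> V s)))}"

definition zn_id :: "('a, 's) zn_space \<Rightarrow> ('a, 's, 'a, 's) zn_morphism"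
  where "zn_id S =
    \<lparr>pmap = restrict (\<lambda>x. x) (topspace (base S)),
     pull = (\<lambda>V. if openin (base S) V then restrict (\<lambda>s. s) (carrier (sec S V))
                 else (\<lambda>_. undefined))\<rparr>"

text \<open>The composite \<open>S \<rightarrow> T \<rightarrow> R\<close> of \<open>\<phi> : S \<rightarrow> T\<close> and \<open>\<psi> : T \<rightarrow> R\<close>, i.e.\ \<open>\<psi> \<circ> \<phi>\<close>.\<close>

definition zn_comp ::
    "('a, 's) zn_space \<Rightarrow> ('b, 't) zn_space \<Rightarrow> ('c, 'u) zn_space \<Rightarrow>
     ('b, 't, 'c, 'u) zn_morphism \<Rightarrow> ('a, 's, 'b, 't) zn_morphism \<Rightarrow> ('a, 's, 'c, 'u) zn_morphism"
  where "zn_comp S T R \<psi> \<phi> =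
    \<lparr>pmap = compose (topspace (base S)) (pmap \<psi>) (pmap \<phi>),
     pull = (\<lambda>V. if openin (base R) V
                 then compose (carrier (sec R V)) (pull \<phi> (preimg T \<psi> V)) (pull \<psi> V)
                 else (\<lambda>_. undefined))\<rparr>"

definition zn_isomorphic :: "nat \<Rightarrow> ('a, 's) zn_space \<Rightarrow> ('b, 't) zn_space \<Rightarrow> bool"
  where "zn_isomorphic n S T \<longleftrightarrow>
    (\<exists>\<phi> \<in> zn_hom n S T. \<exists>\<psi> \<in> zn_hom n T S.
       zn_comp S T S \<psi> \<phi> = zn_id S \<and> zn_comp T S T \<phi> \<psi> = zn_id T)"


section \<open>The model spaces\<close>

definition partial_deriv :: "nat \<Rightarrow> ((nat \<Rightarrow> real) \<Rightarrow> real) \<Rightarrow> (nat \<Rightarrow> real) \<Rightarrow> real"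
  where "partial_deriv i f x = deriv (\<lambda>t. f (x(i := t))) (x i)"

text \<open>\<open>Ck_on p U k f\<close>: \<open>f\<close> is of class \<open>C\<^sup>k\<close> on the open subset \<open>U\<close> of \<open>\<real>\<^sup>p\<close>.\<close>

primrec Ck_on :: "nat \<Rightarrow> (nat \<Rightarrow> real) set \<Rightarrow> nat \<Rightarrow> ((nat \<Rightarrow> real) \<Rightarrow> real) \<Rightarrow> bool"
  where
    "Ck_on p U 0 f \<longleftrightarrow> continuous_map (subtopology (Euclidean_space p) U) euclideanreal f"
  | "Ck_on p U (Suc k) f \<longleftrightarrow>
       continuous_map (subtopology (Euclidean_space p) U) euclideanreal f \<and>
       (\<forall>i<p. (\<forall>x \<in> U. (\<lambda>t. f (x(i := t))) differentiable (at (x i))) \<and>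
              Ck_on p U k (partial_deriv i f))"

definition smooth_on :: "nat \<Rightarrow> (nat \<Rightarrow> real) set \<Rightarrow> ((nat \<Rightarrow> real) \<Rightarrow> real) \<Rightarrow> bool"
  where "smooth_on p U f \<longleftrightarrow> (\<forall>k. Ck_on p U k f)"

text \<open>
  The degrees of the formal variables: \<open>q\<^sub>i\<close> variables of degree \<open>\<gamma>\<^sub>i\<close>.  Below, such a list of
  degrees is called \<open>ds\<close>, and the variable \<open>\<xi>\<^sup>A\<close> is represented by its position \<open>A < length ds\<close>.
\<close>

definition gen_degs :: "nat \<Rightarrow> nat list \<Rightarrow> bit list list"
  where "gen_degs n q = concat (map2 replicate q (zn_gammas n))"

text \<open>
  Exponents \<open>\<alpha>\<close> of the normally ordered monomials \<open>\<xi>\<^sup>\<alpha> = (\<xi>\<^sup>0)\<^sup>\<alpha>\<^sup>0 (\<xi>\<^sup>1)\<^sup>\<alpha>\<^sup>1 \<dots>\<close>.  The commutation rule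
  for \<open>A = B\<close> reads \<open>\<xi>\<^sup>A \<xi>\<^sup>A = - \<xi>\<^sup>A \<xi>\<^sup>A\<close> if \<open>\<langle>deg \<xi>\<^sup>A, deg \<xi>\<^sup>A\<rangle> = 1\<close>, so such variables square to zero;
  all other variables, including those of nonzero degree, have unbounded powers.
\<close>

definition exponents :: "bit list list \<Rightarrow> (nat \<Rightarrow> nat) set"
  where "exponents ds =
    {\<alpha>. (\<forall>A \<ge> length ds. \<alpha> A = 0) \<and>
        (\<forall>A < length ds. zn_pair (ds ! A) (ds ! A) = 1 \<longrightarrow> \<alpha> A \<le> 1)}"

definition monom_deg :: "nat \<Rightarrow> bit list list \<Rightarrow> (nat \<Rightarrow> nat) \<Rightarrow> bit list"
  where "monom_deg n ds \<alpha> = map (\<lambda>i. \<Sum>A<length ds. of_nat (\<alpha> A) * (ds ! A ! i)) [0..<n]"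

text \<open>
  \<open>\<xi>\<^sup>\<alpha> \<xi>\<^sup>\<beta> = monom_sign ds \<alpha> \<beta> \<cdot> \<xi>\<^sup>\<alpha>\<^sup>+\<^sup>\<beta>\<close>: normal ordering moves each \<open>\<xi>\<^sup>B\<close> of the right factor past each
  \<open>\<xi>\<^sup>A\<close> of the left factor with \<open>B < A\<close>.
\<close>

definition monom_sign :: "bit list list \<Rightarrow> (nat \<Rightarrow> nat) \<Rightarrow> (nat \<Rightarrow> nat) \<Rightarrow> real"
  where "monom_sign ds \<alpha> \<beta> =
    zn_sign (\<Sum>A<length ds. \<Sum>B<A. of_nat (\<alpha> A * \<beta> B) * zn_pair (ds ! A) (ds ! B))"

text \<open>
  A formal power series \<open>\<Sum>\<^sub>\<alpha> f\<^sub>\<alpha>(x) \<xi>\<^sup>\<alpha>\<close> over \<open>U\<close> is the family of its coefficients \<open>f\<^sub>\<alpha>\<close>, which are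
  set to \<open>0\<close> outside \<open>U\<close> to make them unique.
\<close>

type_synonym fseries = "(nat \<Rightarrow> nat) \<Rightarrow> (nat \<Rightarrow> real) \<Rightarrow> real"

definition fseries_on :: "nat \<Rightarrow> bit list list \<Rightarrow> (nat \<Rightarrow> real) set \<Rightarrow> fseries set"
  where "fseries_on p ds U =
    {f. \<forall>\<alpha>. smooth_on p U (f \<alpha>) \<and> (\<forall>x. x \<notin> U \<longrightarrow> f \<alpha> x = 0) \<and>
            (\<alpha> \<notin> exponents ds \<longrightarrow> f \<alpha> = (\<lambda>_. 0))}"

definition fseries_algebra ::
    "nat \<Rightarrow> nat \<Rightarrow> bit list list \<Rightarrow> (nat \<Rightarrow> real) set \<Rightarrow> fseries galgebra"
  where "fseries_algebra n p ds U =
    \<lparr>carrier = fseries_on p ds U,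
     mult = (\<lambda>f g \<gamma> x.
       if \<gamma> \<in> exponents ds
       then \<Sum>\<alpha> | \<forall>A. \<alpha> A \<le> \<gamma> A.
              monom_sign ds \<alpha> (\<lambda>A. \<gamma> A - \<alpha> A) * f \<alpha> x * g (\<lambda>A. \<gamma> A - \<alpha> A) x
       else 0),
     one = (\<lambda>\<alpha> x. if \<alpha> = (\<lambda>_. 0) \<and> x \<in> U then 1 else 0),
     zero = (\<lambda>_ _. 0),
     add = (\<lambda>f g \<alpha> x. f \<alpha> x + g \<alpha> x),
     smult = (\<lambda>c f \<alpha> x. c * f \<alpha> x),
     hcomp = (\<lambda>\<gamma>. {f \<in> fseries_on p ds U. \<forall>\<alpha>. f \<alpha> \<noteq> (\<lambda>_. 0) \<longrightarrow> monom_deg n ds \<alpha> = \<gamma>})\<rparr>"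

definition zn_model :: "nat \<Rightarrow> nat \<Rightarrow> nat list \<Rightarrow> (nat \<Rightarrow> real, fseries) zn_space"
  where "zn_model n p q =
    \<lparr>base = Euclidean_space p,
     sec = fseries_algebra n p (gen_degs n q),
     rst = (\<lambda>U V f \<alpha> x. if x \<in> V then f \<alpha> x else 0)\<rparr>"


section \<open>Manifolds and points\<close>

definition zn_manifold_of_dim :: "nat \<Rightarrow> nat \<Rightarrow> nat list \<Rightarrow> ('a, 's) zn_space \<Rightarrow> bool"
  where "zn_manifold_of_dim n p q M \<longleftrightarrow>
    length q = 2 ^ n - 1 \<and> locally_zn_ringed_space n M \<and>
    (\<forall>x \<in> topspace (base M). \<exists>U V.
       openin (base M) U \<and> x \<in> U \<and> openin (Euclidean_space p) V \<and>
       zn_isomorphic n (open_subspace M U) (open_subspace (zn_model n p q) V))"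

definition zn_manifold :: "nat \<Rightarrow> ('a, 's) zn_space \<Rightarrow> bool"
  where "zn_manifold n M \<longleftrightarrow> (\<exists>p q. zn_manifold_of_dim n p q M)"

definition zn_points :: "nat \<Rightarrow> (nat \<Rightarrow> real, fseries) zn_space set"
  where "zn_points n = {zn_model n 0 m | m. length m = 2 ^ n - 1}"

end

theory Submission
  imports Defs
begin

text \<open>
  If \<open>\<phi>\<close> and \<open>\<psi>\<close> differ at a point, a morphism from a point space hitting that point separates them.
  Otherwise they pull some section back to two different sections of \<open>M\<close>, which by the sheaf
  property already differ in a chart with values in \<open>\<real>\<^bsup>p|q\<^esup>\<close>, hence in some coefficient \<open>f\<^sub>\<alpha>\<close> at
  some point \<open>y\<close>.  Evaluating all coefficients at \<open>y\<close> is an algebra homomorphism to the power series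
  over a single point, so it defines a morphism from \<open>\<real>\<^bsup>0|q\<^esup>\<close> that separates the two sections; the
  same \<open>q\<close> as for \<open>M\<close> works.

  That \<open>\<real>\<^bsup>0|q\<^esup>\<close> is a manifold comes down to facts about formal power series with constant
  coefficients: the sign of a product of monomials is bimultiplicative in the exponents, and a
  series with nonzero constant term is invertible, so that the series without constant term form
  the only maximal left ideal.
\<close>

section \<open>Homomorphisms of graded algebras\<close>

lemma zn_algebra_hom_comp:
  assumes "f \<in> zn_algebra_hom n A B" and "g \<in> zn_algebra_hom n B C"
  shows "(\<lambda>x. g (f x)) \<in> zn_algebra_hom n A C"
  using assms ring_hom_trans[of f A B g C]
  by (fastforce simp: zn_algebra_hom_def comp_def ring_hom_def image_subset_iff)

text \<open>Pullbacks in \<open>zn_hom\<close> must be extensional, so homomorphisms get restricted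
  to the carrier. The hypotheses put every argument occurring in the homomorphism laws inside the
  carrier, where the restriction changes nothing.\<close>

lemma zn_algebra_hom_restrict:
  assumes "ring A" and "\<And>\<gamma>. \<gamma> \<in> zn n \<Longrightarrow> hcomp A \<gamma> \<subseteq> carrier A"
    and "\<And>c a. a \<in> carrier A \<Longrightarrow> c \<odot>\<^bsub>A\<^esub> a \<in> carrier A"
    and "f \<in> zn_algebra_hom n A B"
  shows "restrict f (carrier A) \<in> zn_algebra_hom n A B"
proof -
  interpret ring A by fact
  have "restrict f (carrier A) \<in> ring_hom A B"
    using assms(4) by (auto simp: zn_algebra_hom_def intro!: ring_hom_memI dest: ring_hom_memE)
  with assms(2,3,4) show ?thesis
    by (force simp: zn_algebra_hom_def)
qed

lemma zn_algebra_hom_id: "(\<lambda>x. x) \<in> zn_algebra_hom n A A"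
  by (auto simp: zn_algebra_hom_def intro: ring_hom_memI)

lemma zn_algebraD:
  assumes "zn_algebra n A"
  shows "ring A" "module real_ring A"
    and "\<And>\<gamma>. \<gamma> \<in> zn n \<Longrightarrow> hcomp A \<gamma> \<subseteq> carrier A"
    and "\<And>c a. a \<in> carrier A \<Longrightarrow> c \<odot>\<^bsub>A\<^esub> a \<in> carrier A"
proof -
  show "ring A" and m: "module real_ring A"
    using assms by (auto simp: zn_algebra_def)
  show "hcomp A \<gamma> \<subseteq> carrier A" if "\<gamma> \<in> zn n" for \<gamma>
    using assms that module.submoduleE(1)[OF m] by (auto simp: zn_algebra_def)
  show "c \<odot>\<^bsub>A\<^esub> a \<in> carrier A" if "a \<in> carrier A" for c a
    using module.smult_closed[OF m] that by (simp add: ring_of_type_algebra_def)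
qed

lemma zn_algebra_hom_closed:
  "f \<in> zn_algebra_hom n A B \<Longrightarrow> a \<in> carrier A \<Longrightarrow> f a \<in> carrier B"
  by (auto simp: zn_algebra_hom_def dest: ring_hom_closed)

section \<open>Functions on the one-point space and evaluation at a point\<close>

lemma Euclidean_space_0: "Euclidean_space 0 = discrete_topology {\<lambda>_. 0}"
proof -
  have "topspace (Euclidean_space 0) = {\<lambda>_. 0}"
    by (auto simp: topspace_Euclidean_space)
  then show ?thesis
    by (metis subtopology_eq_discrete_topology_sing subtopology_topspace)
qed

text \<open>On a discrete space every function is continuous, and in dimension 0 there are no
  partial derivatives to check.\<close>

lemma smooth_on_0: "smooth_on 0 U f"
proof -
  have "Ck_on 0 U k f" for k
    by (cases k) (auto simp: Euclidean_space_0 subtopology_discrete_topology)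
  then show ?thesis by (simp add: smooth_on_def)
qed

lemma fseries_on_0:
  "f \<in> fseries_on 0 ds U \<longleftrightarrow>
    (\<forall>\<alpha> x. x \<notin> U \<longrightarrow> f \<alpha> x = 0) \<and> (\<forall>\<alpha> x. \<alpha> \<notin> exponents ds \<longrightarrow> f \<alpha> x = 0)"
  by (auto simp: fseries_on_def smooth_on_0 fun_eq_iff)

text \<open>Series are multiplied pointwise in x, so the values at y of the coefficients of a
  product depend only on the values at y of the coefficients of the factors. The assumption is what
  preservation of the unit requires: the unit over V has constant term 1 at y only if y lies in V.
  Taking p = 0 also yields the restriction maps of a point space.\<close>

lemma eval_hom:
  assumes "D = {} \<or> y \<in> V"
  shows "(\<lambda>f \<alpha> z. if z \<in> D then f \<alpha> y else 0)
    \<in> zn_algebra_hom n (fseries_algebra n p ds V) (fseries_algebra n 0 ds D)"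
proof -
  let ?ev = "\<lambda>(f::fseries) \<alpha> z. if z \<in> D then f \<alpha> y else 0"
  have c: "?ev f \<in> fseries_on 0 ds D" if "f \<in> fseries_on p ds V" for f
    using that by (auto simp: fseries_on_def smooth_on_0)
  have "?ev \<in> ring_hom (fseries_algebra n p ds V) (fseries_algebra n 0 ds D)"
    using assms c by (intro ring_hom_memI) (auto simp: fseries_algebra_def fun_eq_iff)
  moreover have "?ev f \<in> hcomp (fseries_algebra n 0 ds D) \<gamma>"
    if f: "f \<in> hcomp (fseries_algebra n p ds V) \<gamma>" for f \<gamma>
  proof -
    have "monom_deg n ds \<alpha> = \<gamma>" if "?ev f \<alpha> \<noteq> (\<lambda>_. 0)" for \<alpha>
    proof -
      have "f \<alpha> \<noteq> (\<lambda>_. 0)" using that by auto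
      with f show ?thesis by (simp add: fseries_algebra_def)
    qed
    with c f show ?thesis by (simp add: fseries_algebra_def)
  qed
  moreover have "?ev (c \<odot>\<^bsub>fseries_algebra n p ds V\<^esub> f) = c \<odot>\<^bsub>fseries_algebra n 0 ds D\<^esub> ?ev f" for c f
    by (simp add: fseries_algebra_def fun_eq_iff)
  ultimately show ?thesis
    by (simp add: zn_algebra_hom_def image_subset_iff)
qed

section \<open>Points through charts\<close>

text \<open>The morphism from the point space to M that evaluates at the point y of a chart. A
  section over an arbitrary open W is first restricted to W \<inter> U, where \<Psi> can pull it
  back. If \<Psi> sends y outside W, the preimage of W is empty and the result is the zero
  section.\<close>

definition chart_point ::
    "('a, 's) zn_space \<Rightarrow> 'a set \<Rightarrow> (nat \<Rightarrow> real, fseries, 'a, 's) zn_morphism \<Rightarrow>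
     (nat \<Rightarrow> real) \<Rightarrow> (nat \<Rightarrow> real, fseries, 'a, 's) zn_morphism"
  where "chart_point M U \<Psi> y =
    \<lparr>pmap = restrict (\<lambda>_. pmap \<Psi> y) {\<lambda>_. 0},
     pull = (\<lambda>W. if openin (base M) W
       then restrict (\<lambda>t \<alpha> z. if z \<in> {\<lambda>_. 0} \<and> pmap \<Psi> y \<in> W
                            then pull \<Psi> (W \<inter> U) (rst M W (W \<inter> U) t) \<alpha> y else 0) (carrier (sec M W))
       else (\<lambda>_. undefined))\<rparr>"

lemma preimg_chart_point:
  "preimg (zn_model n 0 q) (chart_point M U \<Psi> y) W = (if pmap \<Psi> y \<in> W then {\<lambda>_. 0} else {})"
  by (auto simp: preimg_def zn_model_def Euclidean_space_0 chart_point_def)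

text \<open>On sections the map is a composite of three homomorphisms: restriction to W \<inter> U,
  pullback along \<Psi>, evaluation at y. Naturality is inherited from that of \<Psi> and the
  functoriality of restriction.\<close>

lemma chart_point_hom:
  assumes M: "zn_presheaf n M" and U: "openin (base M) U"
    and V: "openin (Euclidean_space p) V"
    and \<Psi>: "\<Psi> \<in> zn_hom n (open_subspace (zn_model n p q) V) (open_subspace M U)"
    and y: "y \<in> V"
  shows "chart_point M U \<Psi> y \<in> zn_hom n (zn_model n 0 q) M"
proof -
  let ?X = "open_subspace (zn_model n p q) V" and ?s = "chart_point M U \<Psi> y"
  let ?P = "zn_model n 0 q"
  have V_top: "topspace (base ?X) = V"
    using openin_subset[OF V] by (auto simp: open_subspace_def zn_model_def)
  have \<Psi>_cont: "continuous_map (base ?X) (subtopology (base M) U) (pmap \<Psi>)"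
    using \<Psi> by (simp add: zn_hom_def open_subspace_def)
  have \<Psi>y: "pmap \<Psi> y \<in> U"
    using continuous_map_image_subset_topspace[OF \<Psi>_cont] y V_top by auto
  have openU: "openin (subtopology (base M) U) (W \<inter> U)" if "openin (base M) W" for W
    using that by (auto simp: openin_subtopology)
  have \<Psi>_pull: "pull \<Psi> (W \<inter> U) \<in> zn_algebra_hom n (sec M (W \<inter> U))
      (fseries_algebra n p (gen_degs n q) (preimg ?X \<Psi> (W \<inter> U)))"
    if "openin (base M) W" for W
    using \<Psi> openU[OF that] by (simp add: zn_hom_def open_subspace_def zn_model_def)
  have rst: "rst M W W' \<in> zn_algebra_hom n (sec M W) (sec M W')"
    if "openin (base M) W" "openin (base M) W'" "W' \<subseteq> W" for W W'
    using M that by (simp add: zn_presheaf_def)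
  have alg: "zn_algebra n (sec M W)" if "openin (base M) W" for W
    using M that by (simp add: zn_presheaf_def)
  have pull: "pull ?s W \<in> zn_algebra_hom n (sec M W) (sec ?P (preimg ?P ?s W))"
    if W: "openin (base M) W" for W
  proof -
    let ?D = "preimg ?P ?s W" and ?E = "preimg ?X \<Psi> (W \<inter> U)"
    \<comment> \<open>The side condition of \<open>eval_hom\<close>: if \<Psi> sends y into W, it
      sends y into W \<inter> U, since its values lie in U.\<close>
    have "?D = {} \<or> y \<in> ?E"
      unfolding preimg_chart_point using \<Psi>y y V_top by (simp add: preimg_def)
    from zn_algebra_hom_comp[OF zn_algebra_hom_comp[OF rst[OF W, of "W \<inter> U"] \<Psi>_pull[OF W]]
        eval_hom[OF this]]
    have *: "(\<lambda>t \<alpha> z. if z \<in> ?D then pull \<Psi> (W \<inter> U) (rst M W (W \<inter> U) t) \<alpha> y else 0)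
        \<in> zn_algebra_hom n (sec M W) (fseries_algebra n 0 (gen_degs n q) ?D)"
      using W U by (simp add: openin_Int)
    have "pull ?s W = restrict (\<lambda>t \<alpha> z. if z \<in> ?D then pull \<Psi> (W \<inter> U) (rst M W (W \<inter> U) t) \<alpha> y else 0)
        (carrier (sec M W))"
      using W unfolding preimg_chart_point by (auto simp: chart_point_def fun_eq_iff restrict_def)
    moreover have "sec ?P ?D = fseries_algebra n 0 (gen_degs n q) ?D"
      by (simp add: zn_model_def)
    ultimately show ?thesis
      using zn_algebra_hom_restrict[OF _ _ _ *] zn_algebraD[OF alg[OF W]] by simp
  qed
  have nat: "pull ?s W' (rst M W W' t) = rst ?P (preimg ?P ?s W) (preimg ?P ?s W') (pull ?s W t)"
    if W: "openin (base M) W" and W': "openin (base M) W'" and "W' \<subseteq> W"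
      and t: "t \<in> carrier (sec M W)" for W W' t
  proof -
    have comp: "rst M V2 V3 (rst M V1 V2 t) = rst M V1 V3 t"
      if "openin (base M) V1" "openin (base M) V2" "openin (base M) V3" "V3 \<subseteq> V2" "V2 \<subseteq> V1"
        "t \<in> carrier (sec M V1)" for V1 V2 V3 t
      using M that by (fastforce simp: zn_presheaf_def)
    have t': "rst M W W' t \<in> carrier (sec M W')" "rst M W (W \<inter> U) t \<in> carrier (sec M (W \<inter> U))"
      using zn_algebra_hom_closed[OF rst] W W' U t \<open>W' \<subseteq> W\<close> by (simp_all add: openin_Int)
    have "pull \<Psi> (W' \<inter> U) (rst M (W \<inter> U) (W' \<inter> U) (rst M W (W \<inter> U) t)) =
        rst ?X (preimg ?X \<Psi> (W \<inter> U)) (preimg ?X \<Psi> (W' \<inter> U)) (pull \<Psi> (W \<inter> U) (rst M W (W \<inter> U) t))"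
    proof -
      have "W' \<inter> U \<subseteq> W \<inter> U" using \<open>W' \<subseteq> W\<close> by auto
      with \<Psi> openU[OF W] openU[OF W'] t'(2) show ?thesis
        unfolding zn_hom_def by (simp add: open_subspace_def)
    qed
    moreover have "rst M (W \<inter> U) (W' \<inter> U) (rst M W (W \<inter> U) t) = rst M W' (W' \<inter> U) (rst M W W' t)"
      using comp W W' U t \<open>W' \<subseteq> W\<close> by (simp add: openin_Int le_infI1)
    \<comment> \<open>Restriction in the model only cuts coefficients off outside the smaller set,
      and y stays inside it.\<close>
    ultimately have "pull \<Psi> (W' \<inter> U) (rst M W' (W' \<inter> U) (rst M W W' t)) \<alpha> y =
        pull \<Psi> (W \<inter> U) (rst M W (W \<inter> U) t) \<alpha> y" if "pmap \<Psi> y \<in> W'" for \<alpha>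
      using that \<Psi>y y openin_subset[OF V] by (auto simp: open_subspace_def zn_model_def preimg_def)
    then show ?thesis
      unfolding preimg_chart_point
      using W W' t t' \<open>W' \<subseteq> W\<close> by (auto simp: chart_point_def zn_model_def fun_eq_iff)
  qed
  have "pmap \<Psi> y \<in> topspace (base M)"
    using \<Psi>y openin_subset[OF U] by auto
  then have cont: "continuous_map (base ?P) (base M) (pmap ?s)"
    by (auto simp: zn_model_def Euclidean_space_0 chart_point_def)
  show ?thesis
    unfolding zn_hom_def mem_Collect_eq
  proof (intro conjI allI impI ballI)
    show "continuous_map (base ?P) (base M) (pmap ?s)" by (fact cont)
    show "pmap ?s \<in> extensional (topspace (base ?P))"
      by (simp add: zn_model_def Euclidean_space_0 chart_point_def)
    show "pull ?s W \<in> zn_algebra_hom n (sec M W) (sec ?P (preimg ?P ?s W))"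
      if "openin (base M) W" for W by (rule pull[OF that])
    show "pull ?s W \<in> extensional (carrier (sec M W))" if "openin (base M) W" for W
      using that by (simp add: chart_point_def)
    show "pull ?s W = (\<lambda>_. undefined)" if "\<not> openin (base M) W" for W
      using that by (simp add: chart_point_def)
    show "pull ?s W' (rst M W W' t) = rst ?P (preimg ?P ?s W) (preimg ?P ?s W') (pull ?s W t)"
      if "openin (base M) W \<and> openin (base M) W' \<and> W' \<subseteq> W" "t \<in> carrier (sec M W)" for W W' t
      using that by (intro nat) simp_all
  qed
qed

lemma zn_chart:
  assumes "zn_manifold_of_dim n p q M" and "x \<in> topspace (base M)"
  obtains U V \<Phi> \<Psi> where "openin (base M) U" "x \<in> U" "openin (Euclidean_space p) V"
    "\<Phi> \<in> zn_hom n (open_subspace M U) (open_subspace (zn_model n p q) V)"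
    "\<Psi> \<in> zn_hom n (open_subspace (zn_model n p q) V) (open_subspace M U)"
    "zn_comp (open_subspace M U) (open_subspace (zn_model n p q) V) (open_subspace M U) \<Psi> \<Phi>
      = zn_id (open_subspace M U)"
  using assms unfolding zn_manifold_of_dim_def zn_isomorphic_def by metis

text \<open>Take the chart point at y = \<Phi>(x); it lands at \<Psi>(\<Phi>(x)) = x.\<close>

lemma point_hits:
  assumes M: "zn_manifold_of_dim n p q M" and x: "x \<in> topspace (base M)"
  shows "\<exists>s \<in> zn_hom n (zn_model n 0 q) M. pmap s (\<lambda>_. 0) = x"
proof -
  obtain U V \<Phi> \<Psi> where U: "openin (base M) U" "x \<in> U" and V: "openin (Euclidean_space p) V"
    and \<Phi>: "\<Phi> \<in> zn_hom n (open_subspace M U) (open_subspace (zn_model n p q) V)"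
    and \<Psi>: "\<Psi> \<in> zn_hom n (open_subspace (zn_model n p q) V) (open_subspace M U)"
    and inv: "zn_comp (open_subspace M U) (open_subspace (zn_model n p q) V) (open_subspace M U) \<Psi> \<Phi>
      = zn_id (open_subspace M U)"
    using zn_chart[OF M x] by metis
  have "continuous_map (subtopology (base M) U) (subtopology (Euclidean_space p) V) (pmap \<Phi>)"
    using \<Phi> by (simp add: zn_hom_def open_subspace_def zn_model_def)
  from continuous_map_image_subset_topspace[OF this] x U(2) have y: "pmap \<Phi> x \<in> V"
    by (auto)
  from arg_cong[OF inv, of "\<lambda>m. pmap m x"] x U(2) have "pmap \<Psi> (pmap \<Phi> x) = x"
    by (simp add: zn_comp_def zn_id_def open_subspace_def compose_def)
  moreover have "zn_presheaf n M"
    using M by (simp add: zn_manifold_of_dim_def locally_zn_ringed_space_def zn_sheaf_def)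
  ultimately show ?thesis
    using chart_point_hom[OF _ U(1) V \<Psi> y] by (force simp: chart_point_def)
qed

text \<open>Locality of the sheaf yields a chart on which the two sections still differ. Pullback
  along the chart is injective, so some coefficient differs at some point y, and the chart point at
  y reads off this coefficient.\<close>

lemma points_separate_sections:
  assumes M: "zn_manifold_of_dim n p q M" and W: "openin (base M) W"
    and a: "a \<in> carrier (sec M W)" and b: "b \<in> carrier (sec M W)" and "a \<noteq> b"
  shows "\<exists>s \<in> zn_hom n (zn_model n 0 q) M. pull s W a \<noteq> pull s W b"
proof -
  have sheaf: "zn_sheaf n M"
    using M by (simp add: zn_manifold_of_dim_def locally_zn_ringed_space_def)
  then have presheaf: "zn_presheaf n M" by (simp add: zn_sheaf_def)
  let ?chart = "\<lambda>U V \<Phi> \<Psi>. openin (base M) U \<and> openin (Euclidean_space p) V \<and>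
    \<Phi> \<in> zn_hom n (open_subspace M U) (open_subspace (zn_model n p q) V) \<and>
    \<Psi> \<in> zn_hom n (open_subspace (zn_model n p q) V) (open_subspace M U) \<and>
    zn_comp (open_subspace M U) (open_subspace (zn_model n p q) V) (open_subspace M U) \<Psi> \<Phi>
      = zn_id (open_subspace M U)"
  \<comment> \<open>The chart domains are cut down to W because the locality axiom concerns sections
    over the union of the family.\<close>
  define \<U> where "\<U> = {W \<inter> U | U. \<exists>V \<Phi> \<Psi>. ?chart U V \<Phi> \<Psi>}"
  have opens: "\<forall>U \<in> \<U>. openin (base M) U"
    using W by (auto simp: \<U>_def)
  have "x \<in> \<Union>\<U>" if "x \<in> W" for x
  proof -
    have "x \<in> topspace (base M)" using that openin_subset[OF W] by auto
    from zn_chart[OF M this] obtain U V \<Phi> \<Psi> where "x \<in> U" "?chart U V \<Phi> \<Psi>" by metis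
    with that show ?thesis unfolding \<U>_def by blast
  qed
  then have cover: "\<Union>\<U> = W"
    by (auto simp: \<U>_def)
  have "\<exists>U' \<in> \<U>. rst M W U' a \<noteq> rst M W U' b"
    using sheaf opens a b \<open>a \<noteq> b\<close> cover unfolding zn_sheaf_def by metis
  then obtain U V \<Phi> \<Psi> where ne: "rst M W (W \<inter> U) a \<noteq> rst M W (W \<inter> U) b"
    and chart: "?chart U V \<Phi> \<Psi>"
    unfolding \<U>_def by blast
  then have U: "openin (base M) U" and V: "openin (Euclidean_space p) V"
    and \<Psi>: "\<Psi> \<in> zn_hom n (open_subspace (zn_model n p q) V) (open_subspace M U)"
    and inv: "zn_comp (open_subspace M U) (open_subspace (zn_model n p q) V) (open_subspace M U) \<Psi> \<Phi>
      = zn_id (open_subspace M U)"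
    by blast+
  let ?X = "open_subspace (zn_model n p q) V"
  let ?f = "pull \<Psi> (W \<inter> U) (rst M W (W \<inter> U) a)" and ?g = "pull \<Psi> (W \<inter> U) (rst M W (W \<inter> U) b)"
  let ?E = "preimg ?X \<Psi> (W \<inter> U)"
  have op: "openin (subtopology (base M) U) (W \<inter> U)"
    using W by (auto simp: openin_subtopology)
  have ab: "rst M W (W \<inter> U) a \<in> carrier (sec M (W \<inter> U))" "rst M W (W \<inter> U) b \<in> carrier (sec M (W \<inter> U))"
  proof -
    have "rst M W (W \<inter> U) \<in> zn_algebra_hom n (sec M W) (sec M (W \<inter> U))"
      using presheaf W U by (simp add: zn_presheaf_def openin_Int)
    from zn_algebra_hom_closed[OF this] a b
    show "rst M W (W \<inter> U) a \<in> carrier (sec M (W \<inter> U))" "rst M W (W \<inter> U) b \<in> carrier (sec M (W \<inter> U))"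
      by simp_all
  qed
  \<comment> \<open>The pullback along the composite \<Psi> \<circ> \<Phi> = id, taken apart; it
    makes the pullback along \<Psi> injective.\<close>
  have left_inv: "pull \<Phi> ?E (pull \<Psi> (W \<inter> U) t) = t" if "t \<in> carrier (sec M (W \<inter> U))" for t
    using arg_cong[OF inv, of "\<lambda>m. pull m (W \<inter> U) t"] op that
    by (simp add: zn_comp_def zn_id_def open_subspace_def compose_def)
  have "?f \<noteq> ?g"
    using left_inv[OF ab(1)] left_inv[OF ab(2)] ne by metis
  then obtain \<alpha> y where y: "?f \<alpha> y \<noteq> ?g \<alpha> y"
    by (meson ext)
  have "pull \<Psi> (W \<inter> U) \<in> zn_algebra_hom n (sec M (W \<inter> U)) (fseries_algebra n p (gen_degs n q) ?E)"
    using \<Psi> op by (simp add: zn_hom_def open_subspace_def zn_model_def)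
  then have "?f \<in> fseries_on p (gen_degs n q) ?E" "?g \<in> fseries_on p (gen_degs n q) ?E"
    using ab zn_algebra_hom_closed by (fastforce simp: fseries_algebra_def)+
  \<comment> \<open>Outside \<open>?E\<close> all coefficients of both series are 0, so they could
    not differ at y.\<close>
  then have "y \<in> ?E"
    using y unfolding fseries_on_def mem_Collect_eq by metis
  then have "y \<in> V" "pmap \<Psi> y \<in> W"
    by (auto simp: preimg_def open_subspace_def)
  then have "pull (chart_point M U \<Psi> y) W a \<alpha> (\<lambda>_. 0) \<noteq> pull (chart_point M U \<Psi> y) W b \<alpha> (\<lambda>_. 0)"
    using y W a b by (simp add: chart_point_def)
  then show ?thesis
    using chart_point_hom[OF presheaf U V \<Psi> \<open>y \<in> V\<close>] by metis
qed

section \<open>Equality and separation of morphisms\<close>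

lemma zn_hom_eqI:
  assumes "\<phi> \<in> zn_hom n S T" and "\<psi> \<in> zn_hom n S T"
    and "\<And>x. x \<in> topspace (base S) \<Longrightarrow> pmap \<phi> x = pmap \<psi> x"
    and "\<And>V t. openin (base T) V \<Longrightarrow> t \<in> carrier (sec T V) \<Longrightarrow> pull \<phi> V t = pull \<psi> V t"
  shows "\<phi> = \<psi>"
proof -
  have "pmap \<phi> = pmap \<psi>"
  proof (rule extensionalityI)
    show "pmap \<phi> \<in> extensional (topspace (base S))" "pmap \<psi> \<in> extensional (topspace (base S))"
      using assms(1,2) by (simp_all add: zn_hom_def)
  qed (fact assms(3))
  moreover have "pull \<phi> V = pull \<psi> V" for V
  proof (cases "openin (base T) V")
    case True
    show ?thesis
    proof (rule extensionalityI)
      show "pull \<phi> V \<in> extensional (carrier (sec T V))" "pull \<psi> V \<in> extensional (carrier (sec T V))"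
        using assms(1,2) True by (simp_all add: zn_hom_def)
    qed (fact assms(4)[OF True])
  next
    case False
    then show ?thesis using assms(1,2) by (simp add: zn_hom_def)
  qed
  then have "pull \<phi> = pull \<psi>" by blast
  ultimately show ?thesis by simp
qed

text \<open>Either the maps of points differ, and a point of M where they do is hit by a point
  space, or some section has two different pullbacks, and a point space separates these.\<close>

lemma points_separate_morphisms:
  assumes M: "zn_manifold_of_dim n p q M"
    and \<phi>: "\<phi> \<in> zn_hom n M T" and \<psi>: "\<psi> \<in> zn_hom n M T" and "\<phi> \<noteq> \<psi>"
  shows "\<exists>s \<in> zn_hom n (zn_model n 0 q) M.
    zn_comp (zn_model n 0 q) M T \<phi> s \<noteq> zn_comp (zn_model n 0 q) M T \<psi> s"
proof (cases "\<forall>x \<in> topspace (base M). pmap \<phi> x = pmap \<psi> x")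
  case False
  then obtain x where x: "x \<in> topspace (base M)" "pmap \<phi> x \<noteq> pmap \<psi> x" by blast
  then obtain s where s: "s \<in> zn_hom n (zn_model n 0 q) M" "pmap s (\<lambda>_. 0) = x"
    using point_hits[OF M] by blast
  let ?c = "\<lambda>\<phi>. zn_comp (zn_model n 0 q) M T \<phi> s"
  have "pmap (?c \<phi>) (\<lambda>_. 0) \<noteq> pmap (?c \<psi>) (\<lambda>_. 0)"
    using x(2) s(2) by (simp add: zn_comp_def zn_model_def Euclidean_space_0 compose_def)
  then show ?thesis using s(1) by metis
next
  case True
  then obtain V t where V: "openin (base T) V" and t: "t \<in> carrier (sec T V)"
    and ne: "pull \<phi> V t \<noteq> pull \<psi> V t"
    using zn_hom_eqI[OF \<phi> \<psi>] \<open>\<phi> \<noteq> \<psi>\<close> by blast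
  \<comment> \<open>With equal maps of points both pullbacks are sections over the same open set,
    hence comparable.\<close>
  have pre: "preimg M \<psi> V = preimg M \<phi> V"
    using True by (auto simp: preimg_def)
  have "continuous_map (base M) (base T) (pmap \<phi>)"
    using \<phi> by (simp add: zn_hom_def)
  then have W: "openin (base M) (preimg M \<phi> V)"
    using V by (simp add: preimg_def openin_continuous_map_preimage)
  have "pull \<phi> V t \<in> carrier (sec M (preimg M \<phi> V))" "pull \<psi> V t \<in> carrier (sec M (preimg M \<phi> V))"
  proof -
    have "pull \<phi> V \<in> zn_algebra_hom n (sec T V) (sec M (preimg M \<phi> V))"
      "pull \<psi> V \<in> zn_algebra_hom n (sec T V) (sec M (preimg M \<phi> V))"
      using \<phi> \<psi> V pre by (auto simp: zn_hom_def dest: spec[of _ V])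
    then show "pull \<phi> V t \<in> carrier (sec M (preimg M \<phi> V))"
      "pull \<psi> V t \<in> carrier (sec M (preimg M \<phi> V))"
      using t by (simp_all add: zn_algebra_hom_closed)
  qed
  from points_separate_sections[OF M W this ne] obtain s
    where s: "s \<in> zn_hom n (zn_model n 0 q) M"
      "pull s (preimg M \<phi> V) (pull \<phi> V t) \<noteq> pull s (preimg M \<phi> V) (pull \<psi> V t)"
    by blast
  let ?c = "\<lambda>\<phi>. zn_comp (zn_model n 0 q) M T \<phi> s"
  have "pull (?c \<phi>) V t \<noteq> pull (?c \<psi>) V t"
    using s(2) V t pre by (simp add: zn_comp_def compose_def)
  then show ?thesis using s(1) by metis
qed

section \<open>Signed convolution\<close>

lemma zn_sign_add: "zn_sign (a + b) = zn_sign a * zn_sign b"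
  by (cases a; cases b) (simp_all add: zn_sign_def)

lemma zn_sign_square [simp]: "zn_sign a * zn_sign a = 1"
  by (simp add: zn_sign_def)

text \<open>
  The simplifier rewrites sums over \<^typ>\<open>bit\<close> to cardinalities modulo 2, so the algebra of exponent
  sums is done over an arbitrary commutative semiring.
\<close>

lemma exponent_form_add:
  fixes c :: "nat \<Rightarrow> nat \<Rightarrow> 'a::comm_semiring_1"
  shows "(\<Sum>A<L. \<Sum>B<A. of_nat ((\<alpha> A + \<beta> A) * \<gamma> B) * c A B) =
      (\<Sum>A<L. \<Sum>B<A. of_nat (\<alpha> A * \<gamma> B) * c A B) + (\<Sum>A<L. \<Sum>B<A. of_nat (\<beta> A * \<gamma> B) * c A B)"
    and "(\<Sum>A<L. \<Sum>B<A. of_nat (\<gamma> A * (\<alpha> B + \<beta> B)) * c A B) =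
      (\<Sum>A<L. \<Sum>B<A. of_nat (\<gamma> A * \<alpha> B) * c A B) + (\<Sum>A<L. \<Sum>B<A. of_nat (\<gamma> A * \<beta> B) * c A B)"
  by (simp_all add: sum.distrib algebra_simps)

lemma exponent_sum_add:
  fixes c :: "nat \<Rightarrow> 'a::comm_semiring_1"
  shows "(\<Sum>A<L. of_nat (\<alpha> A + \<beta> A) * c A) = (\<Sum>A<L. of_nat (\<alpha> A) * c A) + (\<Sum>A<L. of_nat (\<beta> A) * c A)"
  by (simp add: sum.distrib algebra_simps)

text \<open>The bilinear expansion of the scalar product of two monomial degrees, with
  \<open>c A i\<close> as the i-th coordinate of the degree of the variable A.\<close>

lemma exponent_sum_product:
  fixes c :: "nat \<Rightarrow> nat \<Rightarrow> 'a::comm_semiring_1"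
  shows "(\<Sum>i<n. (\<Sum>A<L. of_nat (\<alpha> A) * c A i) * (\<Sum>B<L. of_nat (\<beta> B) * c B i)) =
    (\<Sum>A<L. \<Sum>B<L. of_nat (\<alpha> A * \<beta> B) * (\<Sum>i<n. c A i * c B i))"
proof -
  have "(\<Sum>i<n. (\<Sum>A<L. of_nat (\<alpha> A) * c A i) * (\<Sum>B<L. of_nat (\<beta> B) * c B i)) =
      (\<Sum>i<n. \<Sum>A<L. \<Sum>B<L. of_nat (\<alpha> A * \<beta> B) * (c A i * c B i))"
    by (simp add: sum_product algebra_simps)
  also have "\<dots> = (\<Sum>A<L. \<Sum>B<L. \<Sum>i<n. of_nat (\<alpha> A * \<beta> B) * (c A i * c B i))"
    by (subst sum.swap, intro sum.cong[OF refl], rule sum.swap)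
  finally show ?thesis by (simp add: sum_distrib_left)
qed

text \<open>The exponent defining the sign is biadditive, and \<open>zn_sign\<close> turns sums into
  products.\<close>

lemma monom_sign_add_left:
  "monom_sign ds (\<lambda>A. \<alpha> A + \<beta> A) \<gamma> = monom_sign ds \<alpha> \<gamma> * monom_sign ds \<beta> \<gamma>"
  unfolding monom_sign_def exponent_form_add zn_sign_add ..

lemma monom_sign_add_right:
  "monom_sign ds \<gamma> (\<lambda>A. \<alpha> A + \<beta> A) = monom_sign ds \<gamma> \<alpha> * monom_sign ds \<gamma> \<beta>"
  unfolding monom_sign_def exponent_form_add zn_sign_add ..

lemma monom_sign_zero [simp]: "monom_sign ds \<alpha> (\<lambda>A. 0) = 1" "monom_sign ds (\<lambda>A. 0) \<alpha> = 1"
  by (simp_all add: monom_sign_def zn_sign_def)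

lemma zn_pair_eq_sum: "length v = n \<Longrightarrow> length w = n \<Longrightarrow> zn_pair v w = (\<Sum>i<n. v ! i * w ! i)"
  by (simp add: zn_pair_def sum_list_sum_nth atLeast0LessThan)

lemma length_monom_deg [simp]: "length (monom_deg n ds \<alpha>) = n"
  by (simp add: monom_deg_def)

lemma monom_deg_in_zn [simp]: "monom_deg n ds \<alpha> \<in> zn n"
  by (simp add: zn_def)

lemma monom_deg_add:
  "monom_deg n ds (\<lambda>A. \<alpha> A + \<beta> A) = zn_add (monom_deg n ds \<alpha>) (monom_deg n ds \<beta>)"
proof (rule nth_equalityI)
  show "monom_deg n ds (\<lambda>A. \<alpha> A + \<beta> A) ! i = zn_add (monom_deg n ds \<alpha>) (monom_deg n ds \<beta>) ! i"
    if "i < length (monom_deg n ds (\<lambda>A. \<alpha> A + \<beta> A))" for i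
    using that exponent_sum_add[of \<alpha> \<beta> "\<lambda>A. ds ! A ! i" "length ds"]
    by (simp only: zn_add_def monom_deg_def length_map length_upt length_zip min.idem nth_zip
      prod.case diff_zero nth_map nth_upt add_0)
qed (simp add: zn_add_def)

lemma zn_pair_monom_deg:
  assumes "\<forall>d \<in> set ds. length d = n"
  shows "zn_pair (monom_deg n ds \<alpha>) (monom_deg n ds \<beta>) =
    (\<Sum>A<length ds. \<Sum>B<length ds. of_nat (\<alpha> A * \<beta> B) * zn_pair (ds ! A) (ds ! B))"
proof -
  have "zn_pair (monom_deg n ds \<alpha>) (monom_deg n ds \<beta>) =
      (\<Sum>i<n. (\<Sum>A<length ds. of_nat (\<alpha> A) * ds ! A ! i) * (\<Sum>B<length ds. of_nat (\<beta> B) * ds ! B ! i))"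
    unfolding zn_pair_eq_sum[OF length_monom_deg length_monom_deg]
    by (intro sum.cong[OF refl])
      (simp only: monom_deg_def nth_map nth_upt length_upt lessThan_iff diff_zero add_0)
  also have "\<dots> = (\<Sum>A<length ds. \<Sum>B<length ds. of_nat (\<alpha> A * \<beta> B) * zn_pair (ds ! A) (ds ! B))"
    unfolding exponent_sum_product using assms
    by (intro sum.cong[OF refl]) (simp only: zn_pair_eq_sum[of _ n] nth_mem lessThan_iff)
  finally show ?thesis .
qed

lemma zn_pair_commute: "length v = length w \<Longrightarrow> zn_pair v w = zn_pair w v"
  by (simp only: zn_pair_eq_sum[of _ "length w"] mult.commute)

text \<open>Splits a square array into lower triangle, diagonal and transposed upper triangle. For
  the pairing of two monomial degrees the triangles are the exponents of the two reordering
  signs.\<close>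

lemma sum_square_split:
  fixes f :: "nat \<Rightarrow> nat \<Rightarrow> 'a::comm_monoid_add"
  shows "(\<Sum>A<L. \<Sum>B<L. f A B) = (\<Sum>A<L. \<Sum>B<A. f A B) + (\<Sum>A<L. f A A) + (\<Sum>A<L. \<Sum>B<A. f B A)"
  by (induction L) (simp_all add: sum.distrib ac_simps)

text \<open>The pairing of the degrees is a double sum over variables: one triangle gives the sign
  of \<alpha>, \<beta>, the other that of \<beta>, \<alpha>. The diagonal vanishes because a
  variable pairing to 1 with itself has exponent at most 1 in \<alpha> + \<beta>, so it occurs in at
  most one factor.\<close>

lemma monom_sign_commute:
  assumes ds: "\<forall>d \<in> set ds. length d = n" and e: "(\<lambda>A. \<alpha> A + \<beta> A) \<in> exponents ds"
  shows "monom_sign ds \<alpha> \<beta> =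
    zn_sign (zn_pair (monom_deg n ds \<alpha>) (monom_deg n ds \<beta>)) * monom_sign ds \<beta> \<alpha>"
proof -
  let ?L = "length ds"
  let ?f = "\<lambda>A B. of_nat (\<alpha> A * \<beta> B) * zn_pair (ds ! A) (ds ! B)"
  have diag: "?f A A = 0" if "A < ?L" for A
  proof (cases "zn_pair (ds ! A) (ds ! A) = 1")
    case True
    with e that have "\<alpha> A + \<beta> A \<le> 1" by (auto simp: exponents_def)
    then have "\<alpha> A * \<beta> A = 0" by (cases "\<alpha> A") auto
    then show ?thesis by (simp only: of_nat_0 mult_zero_left)
  next
    case False
    then have "zn_pair (ds ! A) (ds ! A) = 0" by (cases "zn_pair (ds ! A) (ds ! A)") auto
    then show ?thesis by (simp only: mult_zero_right)
  qed
  have swap: "(\<Sum>A<?L. \<Sum>B<A. ?f B A) =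
      (\<Sum>A<?L. \<Sum>B<A. of_nat (\<beta> A * \<alpha> B) * zn_pair (ds ! A) (ds ! B))"
    proof (intro sum.cong[OF refl])
    fix A B assume "A \<in> {..<?L}" "B \<in> {..<A}"
    then have "zn_pair (ds ! B) (ds ! A) = zn_pair (ds ! A) (ds ! B)"
      using ds by (intro zn_pair_commute) simp
    then show "?f B A = of_nat (\<beta> A * \<alpha> B) * zn_pair (ds ! A) (ds ! B)"
      by (simp only: mult.commute)
  qed
  have "(\<Sum>A<?L. ?f A A) = 0"
    using diag by (intro sum.neutral) blast
  then have "zn_sign (zn_pair (monom_deg n ds \<alpha>) (monom_deg n ds \<beta>)) = monom_sign ds \<alpha> \<beta> * monom_sign ds \<beta> \<alpha>"
    unfolding zn_pair_monom_deg[OF ds] sum_square_split[of ?f] swap monom_sign_def zn_sign_add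
    by (simp only: zn_sign_def if_True mult_1_right simp_thms)
  \<comment> \<open>Signs square to 1, so a factor can be moved to the other side.\<close>
  then show ?thesis
    by (simp add: monom_sign_def)
qed

section \<open>Products of series with constant coefficients\<close>

lemma exponents_mono: "\<gamma> \<in> exponents ds \<Longrightarrow> \<forall>A. \<alpha> A \<le> \<gamma> A \<Longrightarrow> \<alpha> \<in> exponents ds"
  unfolding exponents_def mem_Collect_eq by (metis le_trans le_zero_eq)

lemma zero_in_exponents [simp]: "(\<lambda>_. 0) \<in> exponents ds"
  by (simp add: exponents_def)

text \<open>Exponents below \<gamma> vanish from \<open>length ds\<close> on, and the total degree
  of \<gamma> bounds all their entries uniformly.\<close>

lemma finite_exponents_below:
  assumes "\<gamma> \<in> exponents ds"
  shows "finite {\<alpha>. \<forall>A. \<alpha> A \<le> \<gamma> A}"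
proof -
  let ?L = "length ds"
  have le: "\<gamma> A \<le> (\<Sum>A<?L. \<gamma> A)" if "A < ?L" for A
    using that by (intro member_le_sum) auto
  have "{\<alpha>. \<forall>A. \<alpha> A \<le> \<gamma> A} \<subseteq> {\<alpha>. \<forall>A. (A \<in> {..<?L} \<longrightarrow> \<alpha> A \<in> {..\<Sum>A<?L. \<gamma> A}) \<and> (A \<notin> {..<?L} \<longrightarrow> \<alpha> A = 0)}"
    using assms le by (auto simp: exponents_def) (metis le_trans, metis le_zero_eq not_less)
  then show ?thesis
    by (rule finite_subset) (intro finite_set_of_finite_funs finite_lessThan finite_atMost)
qed

text \<open>The product of \<open>fseries_algebra\<close> at one fixed point x, where the
  coefficients are real numbers. Cutting off outside \<open>exponents ds\<close> expresses that
  variables pairing to 1 with themselves square to zero.\<close>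

definition signed_conv ::
    "bit list list \<Rightarrow> ((nat \<Rightarrow> nat) \<Rightarrow> real) \<Rightarrow> ((nat \<Rightarrow> nat) \<Rightarrow> real) \<Rightarrow> (nat \<Rightarrow> nat) \<Rightarrow> real"
  where "signed_conv ds a b \<gamma> =
    (if \<gamma> \<in> exponents ds
     then \<Sum>\<alpha> | \<forall>A. \<alpha> A \<le> \<gamma> A. monom_sign ds \<alpha> (\<lambda>A. \<gamma> A - \<alpha> A) * a \<alpha> * b (\<lambda>A. \<gamma> A - \<alpha> A)
     else 0)"

text \<open>Both sides are sums over \<alpha> + \<beta> + \<epsilon> = \<gamma>, and
  bimultiplicativity makes both signs the product of the three pairwise signs.\<close>

lemma signed_conv_assoc:
  "signed_conv ds (signed_conv ds a b) c = signed_conv ds a (signed_conv ds b c)"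
proof (rule ext)
  fix \<gamma>
  show "signed_conv ds (signed_conv ds a b) c \<gamma> = signed_conv ds a (signed_conv ds b c) \<gamma>"
  proof (cases "\<gamma> \<in> exponents ds")
    case True
    let ?D = "\<lambda>\<gamma> :: nat \<Rightarrow> nat. {\<alpha>. \<forall>A. \<alpha> A \<le> \<gamma> A}"
    \<comment> \<open>Exponents are closed downwards, so the inner convolutions are not cut
      off.\<close>
    have sub: "(\<lambda>A. \<gamma> A - \<alpha> A) \<in> exponents ds" for \<alpha>
      by (rule exponents_mono[OF True]) simp
    have "signed_conv ds (signed_conv ds a b) c \<gamma> =
        (\<Sum>\<delta>\<in>?D \<gamma>. \<Sum>\<alpha>\<in>?D \<delta>. monom_sign ds \<delta> (\<lambda>A. \<gamma> A - \<delta> A) * monom_sign ds \<alpha> (\<lambda>A. \<delta> A - \<alpha> A) *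
          (a \<alpha> * b (\<lambda>A. \<delta> A - \<alpha> A) * c (\<lambda>A. \<gamma> A - \<delta> A)))"
      using True exponents_mono[OF True]
      by (simp add: signed_conv_def sum_distrib_left sum_distrib_right mult_ac)
    also have "\<dots> = (\<Sum>(\<delta>, \<alpha>) \<in> Sigma (?D \<gamma>) ?D. monom_sign ds \<delta> (\<lambda>A. \<gamma> A - \<delta> A) *
          monom_sign ds \<alpha> (\<lambda>A. \<delta> A - \<alpha> A) * (a \<alpha> * b (\<lambda>A. \<delta> A - \<alpha> A) * c (\<lambda>A. \<gamma> A - \<delta> A)))"
      using finite_exponents_below True exponents_mono[OF True] by (intro sum.Sigma) auto
    also have "\<dots> = (\<Sum>(\<alpha>, \<beta>) \<in> Sigma (?D \<gamma>) (\<lambda>\<alpha>. ?D (\<lambda>A. \<gamma> A - \<alpha> A)).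
          monom_sign ds \<alpha> (\<lambda>A. \<gamma> A - \<alpha> A) * monom_sign ds \<beta> (\<lambda>A. \<gamma> A - \<alpha> A - \<beta> A) *
          (a \<alpha> * b \<beta> * c (\<lambda>A. \<gamma> A - \<alpha> A - \<beta> A)))"
    \<comment> \<open>With \<delta> = \<alpha> + \<beta>, the pair (\<delta>, \<alpha>) is exchanged
      for (\<alpha>, \<beta>).\<close>
    proof (rule sum.reindex_bij_witness[where i = "\<lambda>(\<alpha>, \<beta>). (\<lambda>A. \<alpha> A + \<beta> A, \<alpha>)"
          and j = "\<lambda>(\<delta>, \<alpha>). (\<alpha>, \<lambda>A. \<delta> A - \<alpha> A)"], goal_cases)
      case (1 x) then show ?case by (auto simp: fun_eq_iff)
    next
      case (2 x) then show ?case by (auto intro: diff_le_mono order_trans)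
    next
      case (3 x) then show ?case by (auto simp: fun_eq_iff)
    next
      case (4 x) then show ?case
        by (auto simp: le_diff_conv2) (metis add.commute le_diff_conv2)
    next
      case (5 x)
      then obtain \<delta> \<alpha> where x: "x = (\<delta>, \<alpha>)" and le: "\<delta> A \<le> \<gamma> A" "\<alpha> A \<le> \<delta> A" for A by auto
      define \<beta> where "\<beta> = (\<lambda>A. \<delta> A - \<alpha> A)"
      define \<epsilon> where "\<epsilon> = (\<lambda>A. \<gamma> A - \<delta> A)"
      have eqs: "(\<lambda>A. \<gamma> A - \<alpha> A) = (\<lambda>A. \<beta> A + \<epsilon> A)" "\<delta> = (\<lambda>A. \<alpha> A + \<beta> A)"
        "(\<lambda>A. \<gamma> A - \<alpha> A - \<beta> A) = \<epsilon>"
        using le by (auto simp: \<beta>_def \<epsilon>_def fun_eq_iff)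
      have "monom_sign ds \<delta> \<epsilon> * monom_sign ds \<alpha> \<beta> = monom_sign ds \<alpha> (\<lambda>A. \<gamma> A - \<alpha> A) * monom_sign ds \<beta> \<epsilon>"
        unfolding eqs(1) by (subst eqs(2)) (simp add: monom_sign_add_left monom_sign_add_right)
      then show ?case
        by (simp only: x prod.case \<beta>_def[symmetric] \<epsilon>_def[symmetric] eqs(3))
    qed
    also have "\<dots> = (\<Sum>\<alpha>\<in>?D \<gamma>. \<Sum>\<beta>\<in>?D (\<lambda>A. \<gamma> A - \<alpha> A).
          monom_sign ds \<alpha> (\<lambda>A. \<gamma> A - \<alpha> A) * monom_sign ds \<beta> (\<lambda>A. \<gamma> A - \<alpha> A - \<beta> A) *
          (a \<alpha> * b \<beta> * c (\<lambda>A. \<gamma> A - \<alpha> A - \<beta> A)))"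
      using finite_exponents_below[OF True] finite_exponents_below[OF sub]
      by (intro sum.Sigma[symmetric]) auto
    also have "\<dots> = signed_conv ds a (signed_conv ds b c) \<gamma>"
      using True sub by (simp add: signed_conv_def sum_distrib_left mult_ac)
    finally show ?thesis .
  qed (simp add: signed_conv_def)
qed

text \<open>Only the term \<alpha> = 0 survives, and its sign is 1. The constant \<open>c\<close> is
  general because the unit over U has constant term 1 on U but 0 elsewhere.\<close>

lemma signed_conv_one_left:
  assumes "\<gamma> \<in> exponents ds"
  shows "signed_conv ds (\<lambda>\<alpha>. if \<alpha> = (\<lambda>_. 0) then c else 0) b \<gamma> = c * b \<gamma>"
proof -
  have "signed_conv ds (\<lambda>\<alpha>. if \<alpha> = (\<lambda>_. 0) then c else 0) b \<gamma> =
      (\<Sum>\<alpha> | \<forall>A. \<alpha> A \<le> \<gamma> A. if \<alpha> = (\<lambda>_. 0) then c * b \<gamma> else 0)"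
    using assms by (auto simp: signed_conv_def intro!: sum.cong)
  then show ?thesis
    using finite_exponents_below[OF assms] by (simp add: sum.delta)
qed

lemma sum_below_reflect:
  fixes f :: "(nat \<Rightarrow> nat) \<Rightarrow> (nat \<Rightarrow> nat) \<Rightarrow> 'a::comm_monoid_add"
  shows "(\<Sum>\<alpha> | \<forall>A. \<alpha> A \<le> \<gamma> A. f \<alpha> (\<lambda>A. \<gamma> A - \<alpha> A)) = (\<Sum>\<alpha> | \<forall>A. \<alpha> A \<le> \<gamma> A. f (\<lambda>A. \<gamma> A - \<alpha> A) \<alpha>)"
  by (rule sum.reindex_bij_witness[where i = "\<lambda>\<alpha> A. \<gamma> A - \<alpha> A" and j = "\<lambda>\<alpha> A. \<gamma> A - \<alpha> A"]) auto

lemma signed_conv_one_right: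
  assumes "\<gamma> \<in> exponents ds"
  shows "signed_conv ds a (\<lambda>\<alpha>. if \<alpha> = (\<lambda>_. 0) then c else 0) \<gamma> = a \<gamma> * c"
proof -
  have "signed_conv ds a (\<lambda>\<alpha>. if \<alpha> = (\<lambda>_. 0) then c else 0) \<gamma> =
      (\<Sum>\<alpha> | \<forall>A. \<alpha> A \<le> \<gamma> A. monom_sign ds (\<lambda>A. \<gamma> A - \<alpha> A) \<alpha> * a (\<lambda>A. \<gamma> A - \<alpha> A) * (if \<alpha> = (\<lambda>_. 0) then c else 0))"
    using assms
      sum_below_reflect[of "\<lambda>\<alpha> \<beta>. monom_sign ds \<alpha> \<beta> * a \<alpha> * (if \<beta> = (\<lambda>_. 0) then c else 0)" \<gamma>]
    by (simp add: signed_conv_def)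
  also have "\<dots> = (\<Sum>\<alpha> | \<forall>A. \<alpha> A \<le> \<gamma> A. if \<alpha> = (\<lambda>_. 0) then a \<gamma> * c else 0)"
    by (auto intro!: sum.cong)
  finally show ?thesis
    using finite_exponents_below[OF assms] by (simp add: sum.delta)
qed

text \<open>A nonzero coefficient at \<gamma> contains a nonzero term, and there the degrees of
  \<alpha> and \<gamma> - \<alpha> add up to that of \<gamma>. For commutativity, exchange \<alpha>
  with \<gamma> - \<alpha> in the sum and reorder each term by
  \<open>monom_sign_commute\<close>.\<close>

lemma signed_conv_graded:
  assumes ds: "\<forall>d \<in> set ds. length d = n"
    and a: "\<And>\<alpha>. a \<alpha> \<noteq> 0 \<Longrightarrow> monom_deg n ds \<alpha> = \<delta>" and b: "\<And>\<alpha>. b \<alpha> \<noteq> 0 \<Longrightarrow> monom_deg n ds \<alpha> = \<epsilon>"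
  shows "signed_conv ds a b \<gamma> \<noteq> 0 \<Longrightarrow> monom_deg n ds \<gamma> = zn_add \<delta> \<epsilon>"
    and "signed_conv ds a b \<gamma> = zn_sign (zn_pair \<delta> \<epsilon>) * signed_conv ds b a \<gamma>"
proof -
  have plus: "(\<lambda>A. \<alpha> A + (\<gamma> A - \<alpha> A)) = \<gamma>" if "\<forall>A. \<alpha> A \<le> \<gamma> A" for \<alpha>
    using that by auto
  show "monom_deg n ds \<gamma> = zn_add \<delta> \<epsilon>" if "signed_conv ds a b \<gamma> \<noteq> 0"
  proof -
    from that obtain \<alpha> where \<alpha>: "\<forall>A. \<alpha> A \<le> \<gamma> A" "a \<alpha> \<noteq> 0" "b (\<lambda>A. \<gamma> A - \<alpha> A) \<noteq> 0"
      by (auto simp: signed_conv_def split: if_splits elim!: sum.not_neutral_contains_not_neutral)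
    show ?thesis
      using monom_deg_add[of n ds \<alpha> "\<lambda>A. \<gamma> A - \<alpha> A"] a[OF \<alpha>(2)] b[OF \<alpha>(3)] by (simp add: plus[OF \<alpha>(1)])
  qed
  show "signed_conv ds a b \<gamma> = zn_sign (zn_pair \<delta> \<epsilon>) * signed_conv ds b a \<gamma>"
  proof (cases "\<gamma> \<in> exponents ds")
    case True
    have "monom_sign ds \<alpha> (\<lambda>A. \<gamma> A - \<alpha> A) * a \<alpha> * b (\<lambda>A. \<gamma> A - \<alpha> A) =
        zn_sign (zn_pair \<delta> \<epsilon>) * (monom_sign ds (\<lambda>A. \<gamma> A - \<alpha> A) \<alpha> * b (\<lambda>A. \<gamma> A - \<alpha> A) * a \<alpha>)"
      if \<alpha>: "\<forall>A. \<alpha> A \<le> \<gamma> A" for \<alpha>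
    \<comment> \<open>If either coefficient is 0, both sides vanish; otherwise the two degrees are
      \<delta> and \<epsilon>.\<close>
    proof (cases "a \<alpha> = 0 \<or> b (\<lambda>A. \<gamma> A - \<alpha> A) = 0")
      case False
      then show ?thesis
        using monom_sign_commute[OF ds, of \<alpha> "\<lambda>A. \<gamma> A - \<alpha> A"] True a b by (simp add: plus[OF \<alpha>])
    qed auto
    then have "signed_conv ds a b \<gamma> = (\<Sum>\<alpha> | \<forall>A. \<alpha> A \<le> \<gamma> A. zn_sign (zn_pair \<delta> \<epsilon>) *
        (monom_sign ds (\<lambda>A. \<gamma> A - \<alpha> A) \<alpha> * b (\<lambda>A. \<gamma> A - \<alpha> A) * a \<alpha>))"
      using True by (auto simp: signed_conv_def intro!: sum.cong)
    also have "\<dots> = zn_sign (zn_pair \<delta> \<epsilon>) * signed_conv ds b a \<gamma>"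
      using True sum_below_reflect[of "\<lambda>\<alpha> \<beta>. monom_sign ds \<alpha> \<beta> * b \<alpha> * a \<beta>" \<gamma>]
      by (simp add: signed_conv_def sum_distrib_left)
    finally show ?thesis .
  qed (simp add: signed_conv_def)
qed

text \<open>The coefficients of the inverse are found in order of increasing total degree.\<close>

lemma signed_conv_left_inverse:
  assumes "b (\<lambda>_. 0) \<noteq> 0"
  obtains a where "\<And>\<gamma>. \<gamma> \<notin> exponents ds \<Longrightarrow> a \<gamma> = 0"
    and "\<And>\<gamma>. signed_conv ds a b \<gamma> = (if \<gamma> = (\<lambda>_. 0) then 1 else 0)"
proof -
  let ?deg = "\<lambda>\<gamma> :: nat \<Rightarrow> nat. \<Sum>A<length ds. \<gamma> A"
  \<comment> \<open>The product at \<gamma> without its term \<alpha> = \<gamma>. That term is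
    \<open>a \<gamma> * b (\<lambda>_. 0)\<close>, so the equation can be solved for
    \<open>a \<gamma>\<close>.\<close>
  let ?S = "\<lambda>f \<gamma>. \<Sum>\<alpha> | (\<forall>A. \<alpha> A \<le> \<gamma> A) \<and> \<alpha> \<noteq> \<gamma>.
    monom_sign ds \<alpha> (\<lambda>A. \<gamma> A - \<alpha> A) * f \<alpha> * b (\<lambda>A. \<gamma> A - \<alpha> A)"
  have deg: "?deg \<alpha> < ?deg \<gamma>" if "\<gamma> \<in> exponents ds" "\<forall>A. \<alpha> A \<le> \<gamma> A" "\<alpha> \<noteq> \<gamma>" for \<alpha> \<gamma>
  proof -
    obtain A where "\<alpha> A \<noteq> \<gamma> A" using \<open>\<alpha> \<noteq> \<gamma>\<close> by auto
    with that(2) have A: "\<alpha> A < \<gamma> A" by (simp add: le_neq_implies_less)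
    have "A < length ds"
    proof (rule ccontr)
      assume "\<not> A < length ds"
      with that(1) have "\<gamma> A = 0" by (simp add: exponents_def)
      with A show False by simp
    qed
    then show ?thesis using A that(2) by (intro sum_strict_mono_ex1) auto
  qed
  \<comment> \<open>Well-founded recursion: \<open>?S a \<gamma>\<close> involves \<open>a\<close>
    only at exponents of smaller total degree.\<close>
  have "\<exists>a. \<forall>\<gamma>. a \<gamma> = (if \<gamma> \<in> exponents ds
      then ((if \<gamma> = (\<lambda>_. 0) then 1 else 0) - ?S a \<gamma>) / b (\<lambda>_. 0) else 0)"
  proof (rule dependent_wf_choice[where R = "Wellfounded.measure ?deg"], goal_cases)
    case 1 show ?case by simp
  next
    case (2 f g \<gamma> r)
    have "?S f \<gamma> = ?S g \<gamma>" if "\<gamma> \<in> exponents ds"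
      using 2 deg[OF that] by (intro sum.cong[OF refl]) auto
    then show ?case by simp
  qed simp
  then obtain a where a: "a \<gamma> = (if \<gamma> \<in> exponents ds
      then ((if \<gamma> = (\<lambda>_. 0) then 1 else 0) - ?S a \<gamma>) / b (\<lambda>_. 0) else 0)" for \<gamma>
    by blast
  have "signed_conv ds a b \<gamma> = (if \<gamma> = (\<lambda>_. 0) then 1 else 0)" for \<gamma>
  proof (cases "\<gamma> \<in> exponents ds")
    case True
    have "{\<alpha>. \<forall>A. \<alpha> A \<le> \<gamma> A} = insert \<gamma> {\<alpha>. (\<forall>A. \<alpha> A \<le> \<gamma> A) \<and> \<alpha> \<noteq> \<gamma>}" by auto
    moreover have "finite {\<alpha>. (\<forall>A. \<alpha> A \<le> \<gamma> A) \<and> \<alpha> \<noteq> \<gamma>}"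
      by (rule finite_subset[OF _ finite_exponents_below[OF True]]) auto
    ultimately have "signed_conv ds a b \<gamma> = a \<gamma> * b (\<lambda>_. 0) + ?S a \<gamma>"
      using True by (simp add: signed_conv_def)
    also have "\<dots> = (if \<gamma> = (\<lambda>_. 0) then 1 else 0)"
      using True assms by (subst a) simp
    finally show ?thesis .
  qed (auto simp: signed_conv_def)
  moreover have "a \<gamma> = 0" if "\<gamma> \<notin> exponents ds" for \<gamma>
    using that by (subst a) simp
  ultimately show ?thesis
    using that by blast
qed

section \<open>The spaces over a single point\<close>

text \<open>Reduces the laws of the algebra to those of \<open>signed_conv\<close>, one point x at a
  time.\<close>

lemma mult_fseries_algebra:
  "(f \<otimes>\<^bsub>fseries_algebra n p ds U\<^esub> g) = (\<lambda>\<gamma> x. signed_conv ds (\<lambda>\<alpha>. f \<alpha> x) (\<lambda>\<alpha>. g \<alpha> x) \<gamma>)"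
  by (simp add: fseries_algebra_def signed_conv_def fun_eq_iff)

lemma fseries_algebra_simps:
  "carrier (fseries_algebra n p ds U) = fseries_on p ds U"
  "\<one>\<^bsub>fseries_algebra n p ds U\<^esub> = (\<lambda>\<alpha> x. if \<alpha> = (\<lambda>_. 0) \<and> x \<in> U then 1 else 0)"
  "\<zero>\<^bsub>fseries_algebra n p ds U\<^esub> = (\<lambda>_ _. 0)"
  "(f \<oplus>\<^bsub>fseries_algebra n p ds U\<^esub> g) = (\<lambda>\<alpha> x. f \<alpha> x + g \<alpha> x)"
  "(c \<odot>\<^bsub>fseries_algebra n p ds U\<^esub> f) = (\<lambda>\<alpha> x. c * f \<alpha> x)"
  by (simp_all add: fseries_algebra_def)

lemma hcomp_fseries_algebra:
  "f \<in> hcomp (fseries_algebra n p ds U) \<gamma> \<longleftrightarrow>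
    f \<in> fseries_on p ds U \<and> (\<forall>\<alpha> x. monom_deg n ds \<alpha> \<noteq> \<gamma> \<longrightarrow> f \<alpha> x = 0)"
  by (auto simp: fseries_algebra_def fun_eq_iff)

lemma signed_conv_distrib:
  "signed_conv ds (\<lambda>\<alpha>. a \<alpha> + b \<alpha>) c \<gamma> = signed_conv ds a c \<gamma> + signed_conv ds b c \<gamma>"
  "signed_conv ds c (\<lambda>\<alpha>. a \<alpha> + b \<alpha>) \<gamma> = signed_conv ds c a \<gamma> + signed_conv ds c b \<gamma>"
  by (simp_all add: signed_conv_def sum.distrib algebra_simps)

lemma signed_conv_scale:
  "signed_conv ds (\<lambda>\<alpha>. r * a \<alpha>) b \<gamma> = r * signed_conv ds a b \<gamma>"
  "signed_conv ds a (\<lambda>\<alpha>. r * b \<alpha>) \<gamma> = r * signed_conv ds a b \<gamma>"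
  by (simp_all add: signed_conv_def sum_distrib_left algebra_simps)

lemma signed_conv_zero [simp]:
  "signed_conv ds (\<lambda>\<alpha>. 0) b \<gamma> = 0" "\<gamma> \<notin> exponents ds \<Longrightarrow> signed_conv ds a b \<gamma> = 0"
  by (simp_all add: signed_conv_def)

lemma ring_fseries_algebra_0: "ring (fseries_algebra n 0 ds U)" (is "ring ?A")
proof (rule ringI)
  show "abelian_group ?A"
  proof (rule abelian_groupI)
    fix f assume "f \<in> carrier ?A"
    then show "\<exists>g \<in> carrier ?A. g \<oplus>\<^bsub>?A\<^esub> f = \<zero>\<^bsub>?A\<^esub>"
      by (intro bexI[of _ "\<lambda>\<alpha> x. - f \<alpha> x"]) (auto simp: fseries_algebra_simps fseries_on_0)
  qed (auto simp: fseries_algebra_simps fseries_on_0 add_ac)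
  \<comment> \<open>Brings the unit into the form of \<open>signed_conv_one_left\<close>, with
    constant 1 or 0. At points outside U the constant is 0, which is still right since f vanishes
    there.\<close>
  have one: "(\<lambda>\<alpha>. (if \<alpha> = (\<lambda>_. 0) \<and> x \<in> U then 1 else 0) :: real) =
      (\<lambda>\<alpha>. if \<alpha> = (\<lambda>_. 0) then (if x \<in> U then 1 else 0) else 0)" for x :: "nat \<Rightarrow> real"
    by auto
  have unit: "signed_conv ds (\<lambda>\<alpha>. if \<alpha> = (\<lambda>_. 0) \<and> x \<in> U then 1 else 0) (\<lambda>\<alpha>. f \<alpha> x) \<gamma> = f \<gamma> x"
    "signed_conv ds (\<lambda>\<alpha>. f \<alpha> x) (\<lambda>\<alpha>. if \<alpha> = (\<lambda>_. 0) \<and> x \<in> U then 1 else 0) \<gamma> = f \<gamma> x"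
    if "f \<in> fseries_on 0 ds U" for f x \<gamma>
    using that unfolding one fseries_on_0
    by (cases "\<gamma> \<in> exponents ds"; simp add: signed_conv_one_left signed_conv_one_right)+
  show "monoid ?A"
  proof (rule monoidI)
    fix f g assume "f \<in> carrier ?A" "g \<in> carrier ?A"
    then show "f \<otimes>\<^bsub>?A\<^esub> g \<in> carrier ?A"
      unfolding mult_fseries_algebra by (simp add: fseries_algebra_simps fseries_on_0)
  qed (auto simp: mult_fseries_algebra signed_conv_assoc fseries_algebra_simps unit fseries_on_0)
qed (simp_all add: mult_fseries_algebra fseries_algebra_simps signed_conv_distrib)

lemma module_fseries_algebra_0: "module real_ring (fseries_algebra n 0 ds U)"
  using ring.is_abelian_group[OF ring_fseries_algebra_0]
  by (intro moduleI cring_from_type_algebra)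
    (auto simp: ring_of_type_algebra_def fseries_algebra_simps fseries_on_0 algebra_simps)

lemma finsum_fseries_algebra_0:
  assumes "finite I" and "c \<in> I \<rightarrow> fseries_on 0 ds U"
  shows "finsum (fseries_algebra n 0 ds U) c I = (\<lambda>\<alpha> x. \<Sum>i\<in>I. c i \<alpha> x)"
proof -
  interpret ring "fseries_algebra n 0 ds U" by (rule ring_fseries_algebra_0)
  show ?thesis
    using assms by (induction I rule: finite_induct) (simp_all add: fseries_algebra_simps Pi_iff)
qed

lemma finite_zn: "finite (zn n)"
proof -
  have "UNIV = {0, 1 :: bit}" by auto
  then have "finite (UNIV :: bit set)" by (metis finite.intros)
  from finite_lists_length_eq[OF this, of n] show ?thesis by (simp add: zn_def)
qed

lemma zn_algebra_fseries_algebra_0: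
  assumes ds: "\<forall>d \<in> set ds. length d = n"
  shows "zn_algebra n (fseries_algebra n 0 ds U)" (is "zn_algebra n ?A")
proof -
  interpret A: module real_ring ?A by (rule module_fseries_algebra_0)
  have sub: "submodule (hcomp ?A \<gamma>) real_ring ?A" for \<gamma>
  proof (rule A.submoduleI)
    fix f assume f: "f \<in> hcomp ?A \<gamma>"
    have "(\<lambda>\<alpha> x. - f \<alpha> x) \<oplus>\<^bsub>?A\<^esub> f = \<zero>\<^bsub>?A\<^esub>"
      by (simp add: fseries_algebra_simps)
    then have "\<ominus>\<^bsub>?A\<^esub> f = (\<lambda>\<alpha> x. - f \<alpha> x)"
      using f by (intro A.minus_equality) (auto simp: fseries_algebra_simps hcomp_fseries_algebra fseries_on_0)
    then show "\<ominus>\<^bsub>?A\<^esub> f \<in> hcomp ?A \<gamma>"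
      using f by (auto simp: fseries_algebra_simps hcomp_fseries_algebra fseries_on_0)
  qed (auto simp: fseries_algebra_simps hcomp_fseries_algebra fseries_on_0)
  have decomp: "\<exists>!c. c \<in> (\<Pi>\<^sub>E \<gamma> \<in> zn n. hcomp ?A \<gamma>) \<and> f = finsum ?A c (zn n)"
    if f: "f \<in> carrier ?A" for f
  proof
    \<comment> \<open>The homogeneous part of degree \<gamma> keeps exactly the monomials of that
      degree.\<close>
    let ?c = "\<lambda>\<gamma>\<in>zn n. \<lambda>\<alpha> x. if monom_deg n ds \<alpha> = \<gamma> then f \<alpha> x else 0"
    have c: "?c \<in> (\<Pi>\<^sub>E \<gamma> \<in> zn n. hcomp ?A \<gamma>)"
      using f by (auto simp: fseries_algebra_simps hcomp_fseries_algebra fseries_on_0)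
    have "?c \<in> zn n \<rightarrow> fseries_on 0 ds U"
      using f by (auto simp: fseries_algebra_simps hcomp_fseries_algebra fseries_on_0)
    from finsum_fseries_algebra_0[OF finite_zn this]
    show "?c \<in> (\<Pi>\<^sub>E \<gamma> \<in> zn n. hcomp ?A \<gamma>) \<and> f = finsum ?A ?c (zn n)"
      using c by (simp add: finite_zn)
  next
    fix c assume c: "c \<in> (\<Pi>\<^sub>E \<gamma> \<in> zn n. hcomp ?A \<gamma>) \<and> f = finsum ?A c (zn n)"
    then have "c \<in> zn n \<rightarrow> fseries_on 0 ds U"
      by (auto simp: hcomp_fseries_algebra PiE_iff)
    from finsum_fseries_algebra_0[OF finite_zn this, of n] c
    have f_eq: "f \<alpha> x = (\<Sum>\<gamma>\<in>zn n. c \<gamma> \<alpha> x)" for \<alpha> x by simp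
    have c_zero: "c \<gamma> \<alpha> x = 0" if "\<gamma> \<in> zn n" "monom_deg n ds \<alpha> \<noteq> \<gamma>" for \<gamma> \<alpha> x
    proof -
      have "c \<gamma> \<in> hcomp ?A \<gamma>" using c that(1) by auto
      with that(2) show ?thesis by (simp add: hcomp_fseries_algebra)
    qed
    \<comment> \<open>Only the component of the degree of \<alpha> contributes to the coefficient at
      \<alpha>, so f determines every component.\<close>
    have "f \<alpha> x = c (monom_deg n ds \<alpha>) \<alpha> x" for \<alpha> x
    proof -
      have "f \<alpha> x = (\<Sum>\<gamma>\<in>zn n. if \<gamma> = monom_deg n ds \<alpha> then c \<gamma> \<alpha> x else 0)"
        unfolding f_eq using c_zero by (intro sum.cong) auto
      then show ?thesis by (simp add: finite_zn)
    qed
    with c_zero c show "c = (\<lambda>\<gamma>\<in>zn n. \<lambda>\<alpha> x. if monom_deg n ds \<alpha> = \<gamma> then f \<alpha> x else 0)"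
      by (intro extensionalityI[where A = "zn n"]) (auto simp: fun_eq_iff PiE_iff)
  qed
  have graded: "f \<otimes>\<^bsub>?A\<^esub> g \<in> hcomp ?A (zn_add \<gamma> \<delta>) \<and>
      f \<otimes>\<^bsub>?A\<^esub> g = zn_sign (zn_pair \<gamma> \<delta>) \<odot>\<^bsub>?A\<^esub> (g \<otimes>\<^bsub>?A\<^esub> f)"
    if f: "f \<in> hcomp ?A \<gamma>" and g: "g \<in> hcomp ?A \<delta>" for \<gamma> \<delta> f g
  proof -
    have fd: "monom_deg n ds \<alpha> = \<gamma>" if "f \<alpha> x \<noteq> 0" for \<alpha> x
      using that f by (auto simp: hcomp_fseries_algebra)
    have gd: "monom_deg n ds \<alpha> = \<delta>" if "g \<alpha> x \<noteq> 0" for \<alpha> x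
      using that g by (auto simp: hcomp_fseries_algebra)
    have conv_deg: "monom_deg n ds \<alpha> = zn_add \<gamma> \<delta>"
      if "signed_conv ds (\<lambda>\<alpha>. f \<alpha> x) (\<lambda>\<alpha>. g \<alpha> x) \<alpha> \<noteq> 0" for \<alpha> x
      using that by (rule signed_conv_graded(1)[OF ds, rotated 2]) (erule fd gd)+
    have conv_comm: "signed_conv ds (\<lambda>\<alpha>. f \<alpha> x) (\<lambda>\<alpha>. g \<alpha> x) \<alpha> =
        zn_sign (zn_pair \<gamma> \<delta>) * signed_conv ds (\<lambda>\<alpha>. g \<alpha> x) (\<lambda>\<alpha>. f \<alpha> x) \<alpha>" for \<alpha> x
      by (rule signed_conv_graded(2)[OF ds]) (erule fd gd)+
    have "f \<otimes>\<^bsub>?A\<^esub> g \<in> fseries_on 0 ds U"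
      using f g by (simp add: mult_fseries_algebra fseries_algebra_simps hcomp_fseries_algebra fseries_on_0)
    moreover have "(f \<otimes>\<^bsub>?A\<^esub> g) \<alpha> x = 0" if "monom_deg n ds \<alpha> \<noteq> zn_add \<gamma> \<delta>" for \<alpha> x
      using that conv_deg[of x \<alpha>] unfolding mult_fseries_algebra by metis
    moreover have "f \<otimes>\<^bsub>?A\<^esub> g = zn_sign (zn_pair \<gamma> \<delta>) \<odot>\<^bsub>?A\<^esub> (g \<otimes>\<^bsub>?A\<^esub> f)"
      unfolding mult_fseries_algebra fseries_algebra_simps by (intro ext conv_comm)
    ultimately show ?thesis by (simp add: hcomp_fseries_algebra)
  qed
  have scale: "(c \<odot>\<^bsub>?A\<^esub> f) \<otimes>\<^bsub>?A\<^esub> g = c \<odot>\<^bsub>?A\<^esub> (f \<otimes>\<^bsub>?A\<^esub> g) \<and>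
      f \<otimes>\<^bsub>?A\<^esub> (c \<odot>\<^bsub>?A\<^esub> g) = c \<odot>\<^bsub>?A\<^esub> (f \<otimes>\<^bsub>?A\<^esub> g)" for c f g
    by (simp add: mult_fseries_algebra fseries_algebra_simps signed_conv_scale)
  show ?thesis
    unfolding zn_algebra_def
    by (intro conjI allI ballI ring_fseries_algebra_0 module_fseries_algebra_0 sub decomp
        scale[THEN conjunct1] scale[THEN conjunct2] graded[THEN conjunct1] graded[THEN conjunct2])
qed

lemma length_in_gen_degs: "\<forall>d \<in> set (gen_degs n q). length d = n"
proof
  fix d assume "d \<in> set (gen_degs n q)"
  then have "d \<in> set (zn_gammas n)"
    by (auto simp: gen_degs_def dest: set_zip_rightD)
  then show "length d = n"
    unfolding set_zn_gammas by (simp add: zn_def)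
qed

section \<open>Criteria for local rings\<close>

text \<open>A left ideal not contained in I has an element with a left inverse, hence contains 1 and
  is the whole ring. So I contains every proper left ideal and is the only maximal one.\<close>

lemma local_ringI:
  assumes R: "ring R" and I: "left_ideal I R" and one: "\<one>\<^bsub>R\<^esub> \<notin> I"
    and inv: "\<And>x. x \<in> carrier R \<Longrightarrow> x \<notin> I \<Longrightarrow> \<exists>y \<in> carrier R. y \<otimes>\<^bsub>R\<^esub> x = \<one>\<^bsub>R\<^esub>"
  shows "local_ring R"
proof -
  interpret ring R by fact
  have top: "J = carrier R" if J: "left_ideal J R" and x: "x \<in> J" "x \<notin> I" for J x
  proof -
    have sub: "J \<subseteq> carrier R"
      using J additive_subgroup.a_subset by (auto simp: left_ideal_def)
    then obtain y where "y \<in> carrier R" "y \<otimes>\<^bsub>R\<^esub> x = \<one>\<^bsub>R\<^esub>" using inv x by blast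
    then have "\<one>\<^bsub>R\<^esub> \<in> J" using J x by (metis left_ideal_def)
    then have "z \<in> J" if "z \<in> carrier R" for z
      using J that by (metis left_ideal_def r_one)
    with sub show ?thesis by blast
  qed
  have "maximal_left_ideal I R"
    unfolding maximal_left_ideal_def using I one top one_closed by blast
  moreover have "J = I" if "maximal_left_ideal J R" for J
    using that I one top one_closed unfolding maximal_left_ideal_def by blast
  ultimately show ?thesis
    unfolding local_ring_def using R by blast
qed

text \<open>Closure under negation follows from multiplication by -1.\<close>

lemma left_idealI:
  assumes R: "ring R" and "I \<subseteq> carrier R" and "\<zero>\<^bsub>R\<^esub> \<in> I"
    and "\<And>x y. x \<in> I \<Longrightarrow> y \<in> I \<Longrightarrow> x \<oplus>\<^bsub>R\<^esub> y \<in> I"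
    and mult: "\<And>a x. a \<in> carrier R \<Longrightarrow> x \<in> I \<Longrightarrow> a \<otimes>\<^bsub>R\<^esub> x \<in> I"
  shows "left_ideal I R"
proof -
  interpret ring R by fact
  have "\<ominus>\<^bsub>R\<^esub> x \<in> I" if "x \<in> I" for x
    using mult[of "\<ominus>\<^bsub>R\<^esub> \<one>\<^bsub>R\<^esub>" x] that assms(2) l_minus[OF one_closed, of x] by auto
  then have "subgroup I (add_monoid R)"
    using assms(2-4) by (intro subgroup.intro) (auto simp: a_inv_def)
  then show ?thesis
    using mult by (simp add: left_ideal_def additive_subgroup_def)
qed

lemma openin_point: "openin (Euclidean_space 0) U \<longleftrightarrow> U = {} \<or> U = {\<lambda>_. 0}"
  by (auto simp: Euclidean_space_0)

text \<open>Transports the criterion along a bijection to a structure, such as a stalk, not yet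
  known to be a ring. The zero is matched by a separate assumption because \<open>ring_iso\<close>
  constrains only the carrier, sum, product and unit.\<close>

lemma local_ring_isoI:
  assumes R: "ring R" and h: "h \<in> ring_iso R S" and zero: "h \<zero>\<^bsub>R\<^esub> = \<zero>\<^bsub>S\<^esub>"
    and I: "left_ideal I R" and one: "\<one>\<^bsub>R\<^esub> \<notin> I"
    and inv: "\<And>x. x \<in> carrier R \<Longrightarrow> x \<notin> I \<Longrightarrow> \<exists>y \<in> carrier R. y \<otimes>\<^bsub>R\<^esub> x = \<one>\<^bsub>R\<^esub>"
  shows "local_ring S"
proof (rule local_ringI)
  interpret R: ring R by fact
  interpret I: additive_subgroup I R using I by (simp add: left_ideal_def)
  have hom: "h \<in> ring_hom R S" and bij: "bij_betw h (carrier R) (carrier S)"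
    using h by (auto simp: ring_iso_def)
  have surj: "h ` carrier R = carrier S" and inj: "inj_on h (carrier R)"
    using bij by (auto simp: bij_betw_def)
  show ring: "ring S"
    using R.ring_iso_imp_img_ring[OF h] by (simp add: zero)
  show "left_ideal (h ` I) S"
  proof (rule left_idealI[OF ring])
    show "h ` I \<subseteq> carrier S" using I.a_subset surj by blast
    show "\<zero>\<^bsub>S\<^esub> \<in> h ` I" using I.zero_closed zero by (metis imageI)
    show "x \<oplus>\<^bsub>S\<^esub> y \<in> h ` I" if x: "x \<in> h ` I" and y: "y \<in> h ` I" for x y
    proof -
      obtain x' y' where x': "x' \<in> I" "x = h x'" and y': "y' \<in> I" "y = h y'"
        using x y by blast
      then have "h (x' \<oplus>\<^bsub>R\<^esub> y') = x \<oplus>\<^bsub>S\<^esub> y"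
        using I.a_subset ring_hom_add[OF hom, of x' y'] by auto
      then show ?thesis using I.a_closed[OF x'(1) y'(1)] by (metis imageI)
    qed
    show "a \<otimes>\<^bsub>S\<^esub> x \<in> h ` I" if a: "a \<in> carrier S" and x: "x \<in> h ` I" for a x
    proof -
      obtain a' x' where a': "a' \<in> carrier R" "a = h a'" and x': "x' \<in> I" "x = h x'"
        using a x surj by blast
      then have "a' \<otimes>\<^bsub>R\<^esub> x' \<in> I" using I by (simp add: left_ideal_def)
      moreover have "h (a' \<otimes>\<^bsub>R\<^esub> x') = a \<otimes>\<^bsub>S\<^esub> x"
        using a' x' I.a_subset ring_hom_mult[OF hom, of a' x'] by auto
      ultimately show ?thesis by (metis imageI)
    qed
  qed
  show "\<one>\<^bsub>S\<^esub> \<notin> h ` I"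
    using ring_hom_one[OF hom] one inj I.a_subset R.one_closed
    by (metis image_iff inj_onD subsetD)
  fix x assume "x \<in> carrier S" "x \<notin> h ` I"
  then obtain x' where x': "x' \<in> carrier R" "x = h x'" "x' \<notin> I" using surj by blast
  then obtain y where "y \<in> carrier R" "y \<otimes>\<^bsub>R\<^esub> x' = \<one>\<^bsub>R\<^esub>" using inv by blast
  then show "\<exists>y \<in> carrier S. y \<otimes>\<^bsub>S\<^esub> x = \<one>\<^bsub>S\<^esub>"
    using x' ring_hom_mult[OF hom, of y x'] ring_hom_one[OF hom] ring_hom_closed[OF hom, of y]
    by (intro bexI[of _ "h y"]) simp_all
qed

section \<open>The local ring, the sheaf and the stalk of a point space\<close>

text \<open>The constant term of a product is the product of the constant terms, as only \<alpha> =
  0 lies below the exponent 0.\<close>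

lemma left_ideal_fseries_algebra_point:
  "left_ideal {f \<in> carrier (fseries_algebra n 0 ds {\<lambda>_. 0}). f (\<lambda>_. 0) (\<lambda>_. 0) = 0}
    (fseries_algebra n 0 ds {\<lambda>_. 0})" (is "left_ideal ?I ?A")
proof (rule left_idealI)
  show ring: "ring ?A" by (rule ring_fseries_algebra_0)
  have below: "{\<alpha>. \<forall>A. \<alpha> A \<le> (0::nat)} = {\<lambda>_. 0 :: nat}" by auto
  fix f g assume f: "f \<in> carrier ?A" and g: "g \<in> ?I"
  have "(f \<otimes>\<^bsub>?A\<^esub> g) (\<lambda>_. 0) (\<lambda>_. 0) = 0"
    using g unfolding mult_fseries_algebra by (simp add: signed_conv_def below)
  then show "f \<otimes>\<^bsub>?A\<^esub> g \<in> ?I"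
    using f g monoid.m_closed[OF ring.is_monoid[OF ring]] by blast
qed (auto simp: fseries_algebra_simps fseries_on_0)

lemma fseries_algebra_point_left_inverse:
  assumes "f \<in> carrier (fseries_algebra n 0 ds {\<lambda>_. 0})" and "f (\<lambda>_. 0) (\<lambda>_. 0) \<noteq> 0"
  shows "\<exists>g \<in> carrier (fseries_algebra n 0 ds {\<lambda>_. 0}).
    g \<otimes>\<^bsub>fseries_algebra n 0 ds {\<lambda>_. 0}\<^esub> f = \<one>\<^bsub>fseries_algebra n 0 ds {\<lambda>_. 0}\<^esub>"
    (is "\<exists>g \<in> carrier ?A. _")
proof -
  obtain a where a: "\<And>\<gamma>. \<gamma> \<notin> exponents ds \<Longrightarrow> a \<gamma> = 0"
    "\<And>\<gamma>. signed_conv ds a (\<lambda>\<alpha>. f \<alpha> (\<lambda>_. 0)) \<gamma> = (if \<gamma> = (\<lambda>_. 0) then 1 else 0)"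
    using signed_conv_left_inverse[of "\<lambda>\<alpha>. f \<alpha> (\<lambda>_. 0)" ds] assms by auto
  let ?g = "\<lambda>\<alpha> x. if x = (\<lambda>_. 0 :: real) then a \<alpha> else 0"
  have "?g \<in> carrier ?A"
    using a(1) by (auto simp: fseries_algebra_simps fseries_on_0)
  moreover have "signed_conv ds (\<lambda>\<alpha>. ?g \<alpha> x) (\<lambda>\<alpha>. f \<alpha> x) \<gamma> = \<one>\<^bsub>?A\<^esub> \<gamma> x" for \<gamma> x
    using a(2) by (cases "x = (\<lambda>_. 0)") (simp_all add: fseries_algebra_simps)
  then have "?g \<otimes>\<^bsub>?A\<^esub> f = \<one>\<^bsub>?A\<^esub>"
    unfolding mult_fseries_algebra by (intro ext)
  ultimately show ?thesis by blast
qed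

lemma zn_presheaf_point: "zn_presheaf n (zn_model n 0 q)"
proof -
  have "rst (zn_model n 0 q) U V \<in> zn_algebra_hom n (sec (zn_model n 0 q) U) (sec (zn_model n 0 q) V)"
    if "V \<subseteq> U" "openin (Euclidean_space 0) V" for U V
  proof -
    have "V = {} \<or> (\<lambda>_. 0) \<in> U" using that by (auto simp: openin_point)
    \<comment> \<open>An open V contains at most the origin, so restriction is evaluation at the
      origin and \<open>eval_hom\<close> applies.\<close>
    moreover have "rst (zn_model n 0 q) U V = (\<lambda>f \<alpha> x. if x \<in> V then f \<alpha> (\<lambda>_. 0) else 0)"
      using that(2) by (auto simp: zn_model_def openin_point fun_eq_iff)
    moreover have "sec (zn_model n 0 q) = fseries_algebra n 0 (gen_degs n q)"
      by (simp add: zn_model_def)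
    ultimately show ?thesis
      using eval_hom by simp
  qed
  moreover have "rst (zn_model n 0 q) U U s = s" if "s \<in> carrier (sec (zn_model n 0 q) U)" for U s
    using that by (auto simp: zn_model_def fseries_algebra_simps fseries_on_0 fun_eq_iff)
  moreover have "rst (zn_model n 0 q) V W (rst (zn_model n 0 q) U V s) = rst (zn_model n 0 q) U W s"
    if "W \<subseteq> V" for U V W s
    using that by (auto simp: zn_model_def fun_eq_iff)
  moreover have "zn_algebra n (sec (zn_model n 0 q) U)" for U
    by (simp add: zn_model_def zn_algebra_fseries_algebra_0 length_in_gen_degs)
  moreover have "base (zn_model n 0 q) = Euclidean_space 0"
    by (simp add: zn_model_def)
  ultimately show ?thesis
    unfolding zn_presheaf_def by simp
qed

text \<open>The only open sets are the empty set, whose only section is 0, and the whole point. A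
  family covering the point has the point as a member, so locality and gluing are read off that
  member.\<close>

lemma zn_sheaf_point: "zn_sheaf n (zn_model n 0 q)"
proof -
  let ?P = "zn_model n 0 q"
  have res: "rst ?P {\<lambda>_. 0} {\<lambda>_. 0} s = s" if "s \<in> carrier (sec ?P {\<lambda>_. 0})" for s
    using that by (auto simp: zn_model_def fseries_algebra_simps fseries_on_0 fun_eq_iff)
  have empty: "carrier (sec ?P {}) = {\<lambda>_ _. 0}"
    by (auto simp: zn_model_def fseries_algebra_simps fseries_on_0 fun_eq_iff)
  have res_empty: "rst ?P U {} s = (\<lambda>_ _. 0)" for U s
    by (simp add: zn_model_def)
  show ?thesis
    unfolding zn_sheaf_def
  proof (intro conjI zn_presheaf_point allI impI)
    fix \<U> assume "\<forall>U \<in> \<U>. openin (base ?P) U"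
    then have \<U>: "U = {} \<or> U = {\<lambda>_. 0}" if "U \<in> \<U>" for U
      using that by (simp add: zn_model_def openin_point)
    consider "{\<lambda>_. 0} \<in> \<U>" "\<Union>\<U> = {\<lambda>_. 0}" | "\<Union>\<U> = {}" "{\<lambda>_. 0} \<notin> \<U>"
      using \<U> by blast
    note cases = this
    show "\<forall>s \<in> carrier (sec ?P (\<Union>\<U>)). \<forall>t \<in> carrier (sec ?P (\<Union>\<U>)).
        (\<forall>U \<in> \<U>. rst ?P (\<Union>\<U>) U s = rst ?P (\<Union>\<U>) U t) \<longrightarrow> s = t"
    proof (intro ballI impI)
      fix s t assume s: "s \<in> carrier (sec ?P (\<Union>\<U>))" and t: "t \<in> carrier (sec ?P (\<Union>\<U>))"
        and st: "\<forall>U \<in> \<U>. rst ?P (\<Union>\<U>) U s = rst ?P (\<Union>\<U>) U t"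
      show "s = t"
      proof (cases rule: cases)
        case 1
        then have "rst ?P {\<lambda>_. 0} {\<lambda>_. 0} s = rst ?P {\<lambda>_. 0} {\<lambda>_. 0} t" using st by metis
        with res s t 1 show ?thesis by metis
      next
        case 2
        with s t empty show ?thesis by (metis singletonD)
      qed
    qed
    fix c assume c: "(\<forall>U \<in> \<U>. c U \<in> carrier (sec ?P U)) \<and>
      (\<forall>U \<in> \<U>. \<forall>V \<in> \<U>. rst ?P U (U \<inter> V) (c U) = rst ?P V (U \<inter> V) (c V))"
    show "\<exists>s \<in> carrier (sec ?P (\<Union>\<U>)). \<forall>U \<in> \<U>. rst ?P (\<Union>\<U>) U s = c U"
    proof (cases rule: cases)
      case 1
      have c0: "c {\<lambda>_. 0} \<in> carrier (sec ?P {\<lambda>_. 0})" using c 1 by blast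
      have "rst ?P {\<lambda>_. 0} U (c {\<lambda>_. 0}) = c U" if "U \<in> \<U>" for U
        using \<U>[OF that]
      proof
        assume U: "U = {}"
        with c that have "c U \<in> carrier (sec ?P {})" by blast
        with empty U show ?thesis by (simp only: res_empty singleton_iff)
      next
        assume "U = {\<lambda>_. 0}"
        then show ?thesis using res[OF c0] by simp
      qed
      with c0 show ?thesis unfolding 1(2) by blast
    next
      case 2
      \<comment> \<open>Here the family is empty or consists of the empty set alone; the zero
        section glues.\<close>
      have "rst ?P {} U (\<lambda>_ _. 0) = c U" if "U \<in> \<U>" for U
      proof -
        have U: "U = {}" using \<U>[OF that] 2 that by metis
        with c that have "c U \<in> carrier (sec ?P {})" by blast
        with empty U show ?thesis by (simp only: res_empty singleton_iff)
      qed
      with empty show ?thesis unfolding 2(1) by blast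
    qed
  qed
qed

text \<open>The origin has just one open neighbourhood, so the germ of s is the singleton of the
  pair of that neighbourhood and s. The stalk is therefore isomorphic to the power series ring,
  which is local.\<close>

lemma local_ring_stalk_point: "local_ring (stalk (zn_model n 0 q) (\<lambda>_. 0))"
proof -
  let ?P = "zn_model n 0 q" and ?A = "fseries_algebra n 0 (gen_degs n q) {\<lambda>_. 0}"
  let ?h = "\<lambda>s. {({\<lambda>_. 0}, s)} :: ((nat \<Rightarrow> real) set \<times> fseries) set"
  have sec: "sec ?P {\<lambda>_. 0} = ?A" by (simp add: zn_model_def)
  have res: "rst ?P {\<lambda>_. 0} {\<lambda>_. 0} s = s" if "s \<in> carrier ?A" for s
    using that by (auto simp: zn_model_def fseries_algebra_simps fseries_on_0 fun_eq_iff)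
  have nbhd: "openin (base ?P) U \<and> (\<lambda>_. 0) \<in> U \<longleftrightarrow> U = {\<lambda>_. 0}" for U
    by (auto simp: zn_model_def openin_point)
  have germ: "germ ?P (\<lambda>_. 0) {\<lambda>_. 0} s = ?h s" if "s \<in> carrier ?A" for s
  proof -
    have "(V, t) \<in> germ ?P (\<lambda>_. 0) {\<lambda>_. 0} s \<longleftrightarrow> V = {\<lambda>_. 0} \<and> t = s" for V t
    proof -
      have "(V, t) \<in> germ ?P (\<lambda>_. 0) {\<lambda>_. 0} s \<longleftrightarrow>
          (openin (base ?P) V \<and> (\<lambda>_. 0) \<in> V) \<and> t \<in> carrier (sec ?P V) \<and>
          (\<exists>W. (openin (base ?P) W \<and> (\<lambda>_. 0) \<in> W) \<and> W \<subseteq> {\<lambda>_. 0} \<inter> V \<and> rst ?P {\<lambda>_. 0} W s = rst ?P V W t)"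
        by (simp add: germ_def conj_assoc)
      also have "\<dots> \<longleftrightarrow> V = {\<lambda>_. 0} \<and> t \<in> carrier ?A \<and> rst ?P {\<lambda>_. 0} {\<lambda>_. 0} s = rst ?P {\<lambda>_. 0} {\<lambda>_. 0} t"
        unfolding nbhd by (auto simp: sec)
      also have "\<dots> \<longleftrightarrow> V = {\<lambda>_. 0} \<and> t = s"
        using res that by metis
      finally show ?thesis .
    qed
    then show ?thesis by auto
  qed
  interpret ring ?A by (rule ring_fseries_algebra_0)
  have top: "topspace (base ?P) = {\<lambda>_. 0}" by (simp add: zn_model_def Euclidean_space_0)
  have carr: "carrier (stalk ?P (\<lambda>_. 0)) = ?h ` carrier ?A"
  proof -
    have "carrier (stalk ?P (\<lambda>_. 0)) =
        {germ ?P (\<lambda>_. 0) U s | U s. (openin (base ?P) U \<and> (\<lambda>_. 0) \<in> U) \<and> s \<in> carrier (sec ?P U)}"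
      by (simp add: stalk_def conj_assoc)
    also have "\<dots> = {germ ?P (\<lambda>_. 0) {\<lambda>_. 0} s | s. s \<in> carrier ?A}"
      unfolding nbhd by (auto simp: sec)
    finally show ?thesis using germ by auto
  qed
  have hom: "?h \<in> ring_hom ?A (stalk ?P (\<lambda>_. 0))"
  proof (rule ring_hom_memI)
    fix s t assume s: "s \<in> carrier ?A" and t: "t \<in> carrier ?A"
    \<comment> \<open>As germs are singletons, the unions in the operations of the stalk run over a
      single pair of representatives.\<close>
    show "?h (s \<otimes>\<^bsub>?A\<^esub> t) = ?h s \<otimes>\<^bsub>stalk ?P (\<lambda>_. 0)\<^esub> ?h t"
      using germ[OF m_closed[OF s t]] res s t by (simp add: stalk_def sec)
    show "?h (s \<oplus>\<^bsub>?A\<^esub> t) = ?h s \<oplus>\<^bsub>stalk ?P (\<lambda>_. 0)\<^esub> ?h t"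
      using germ[OF a_closed[OF s t]] res s t by (simp add: stalk_def sec)
  next
    show "?h \<one>\<^bsub>?A\<^esub> = \<one>\<^bsub>stalk ?P (\<lambda>_. 0)\<^esub>"
      using germ[OF one_closed] by (simp add: stalk_def top sec)
  qed (simp add: carr)
  have "?h \<in> ring_iso ?A (stalk ?P (\<lambda>_. 0))"
    using hom carr by (simp add: ring_iso_def bij_betw_def inj_on_def)
  moreover have "?h \<zero>\<^bsub>?A\<^esub> = \<zero>\<^bsub>stalk ?P (\<lambda>_. 0)\<^esub>"
    using germ[OF zero_closed] by (simp add: stalk_def top sec)
  ultimately show ?thesis
    by (rule local_ring_isoI[OF ring_axioms _ _ left_ideal_fseries_algebra_point])
      (simp add: fseries_algebra_simps(2), blast intro: fseries_algebra_point_left_inverse)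
qed

section \<open>Identity morphisms and the manifold structure of a point space\<close>

lemma zn_id_hom:
  assumes S: "zn_presheaf n S"
  shows "zn_id S \<in> zn_hom n S S"
proof -
  have pre: "preimg S (zn_id S) V = V" if "openin (base S) V" for V
    using openin_subset[OF that] by (auto simp: preimg_def zn_id_def)
  have alg: "zn_algebra n (sec S V)" if "openin (base S) V" for V
    using S that by (simp add: zn_presheaf_def)
  have pull: "pull (zn_id S) V = restrict (\<lambda>s. s) (carrier (sec S V))" if "openin (base S) V" for V
    using that by (simp add: zn_id_def)
  show ?thesis
    unfolding zn_hom_def mem_Collect_eq
  proof (intro conjI allI impI ballI)
    show "continuous_map (base S) (base S) (pmap (zn_id S))"
      by (rule continuous_map_eq[OF continuous_map_id]) (simp add: zn_id_def)
    show "pull (zn_id S) V \<in> zn_algebra_hom n (sec S V) (sec S (preimg S (zn_id S) V))"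
      if V: "openin (base S) V" for V
      unfolding pull[OF V] pre[OF V]
      by (intro zn_algebra_hom_restrict zn_algebraD[OF alg[OF V]] zn_algebra_hom_id)
    show "pull (zn_id S) W (rst S V W s) =
        rst S (preimg S (zn_id S) V) (preimg S (zn_id S) W) (pull (zn_id S) V s)"
      if VW: "openin (base S) V \<and> openin (base S) W \<and> W \<subseteq> V" and s: "s \<in> carrier (sec S V)" for V W s
    proof -
      have "rst S V W s \<in> carrier (sec S W)"
      proof (rule zn_algebra_hom_closed[OF _ s])
        show "rst S V W \<in> zn_algebra_hom n (sec S V) (sec S W)"
          using S VW by (simp add: zn_presheaf_def)
      qed
      then show ?thesis
        using VW s by (simp add: pull pre)
    qed
  qed (simp_all add: zn_id_def)
qed

lemma zn_isomorphic_refl: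
  assumes S: "zn_presheaf n S"
  shows "zn_isomorphic n S S"
proof -
  have "preimg S (zn_id S) V = V" if "openin (base S) V" for V
    using openin_subset[OF that] by (auto simp: preimg_def zn_id_def)
  then have "pull (zn_comp S S S (zn_id S) (zn_id S)) V = pull (zn_id S) V" for V
    by (cases "openin (base S) V") (auto simp: zn_comp_def zn_id_def compose_def)
  moreover have "pmap (zn_comp S S S (zn_id S) (zn_id S)) = pmap (zn_id S)"
    by (auto simp: zn_comp_def zn_id_def compose_def)
  ultimately have "zn_comp S S S (zn_id S) (zn_id S) = zn_id S"
    by (intro zn_morphism.equality ext) simp_all
  then show ?thesis
    unfolding zn_isomorphic_def using zn_id_hom[OF S] by blast
qed

lemma zn_manifold_point:
  assumes "length m = 2 ^ n - 1"
  shows "zn_manifold_of_dim n 0 m (zn_model n 0 m)"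
proof -
  let ?P = "zn_model n 0 m"
  have top: "topspace (base ?P) = {\<lambda>_. 0}" by (simp add: zn_model_def Euclidean_space_0)
  have "second_countable (base ?P)"
    by (simp add: zn_model_def Euclidean_space_0 second_countable_discrete_topology)
  moreover have "Hausdorff_space (base ?P)"
    by (simp add: zn_model_def Hausdorff_Euclidean_space)
  \<comment> \<open>Restricting to the whole space gives back the same record, so the identity
    serves as the single chart.\<close>
  moreover have "open_subspace ?P {\<lambda>_. 0} = ?P"
    using subtopology_topspace[of "base ?P"] by (simp add: open_subspace_def top)
  then have "zn_isomorphic n (open_subspace ?P {\<lambda>_. 0}) (open_subspace ?P {\<lambda>_. 0})"
    using zn_isomorphic_refl[OF zn_presheaf_point] by metis
  moreover have "openin (base ?P) {\<lambda>_. 0}" "openin (Euclidean_space 0) {\<lambda>_. 0}"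
    by (simp_all add: zn_model_def openin_point)
  ultimately show ?thesis
    unfolding zn_manifold_of_dim_def locally_zn_ringed_space_def top
    using assms zn_sheaf_point local_ring_stalk_point by blast
qed

theorem theorem3p8:
  fixes n :: nat
    and M :: "('a, 's) zn_space"
    and N' :: "('b, 't) zn_space"
    and \<phi> \<psi> :: "('a, 's, 'b, 't) zn_morphism"
  assumes "zn_manifold n M"
    and "zn_manifold n N'"
    and "\<phi> \<in> zn_hom n M N'"
    and "\<psi> \<in> zn_hom n M N'"
    and "\<phi> \<noteq> \<psi>"
  shows "zn_points n \<subseteq> {P. zn_manifold n P} \<and>
    (\<exists>P \<in> zn_points n. \<exists>s \<in> zn_hom n P M. zn_comp P M N' \<phi> s \<noteq> zn_comp P M N' \<psi> s)"
proof
  show "zn_points n \<subseteq> {P. zn_manifold n P}"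
    using zn_manifold_point by (auto simp: zn_points_def zn_manifold_def)
  obtain p q where M: "zn_manifold_of_dim n p q M"
    using assms(1) by (auto simp: zn_manifold_def)
  \<comment> \<open>The dimension of M supplies the required length of q.\<close>
  then have "zn_model n 0 q \<in> zn_points n"
    by (auto simp: zn_points_def zn_manifold_of_dim_def)
  with points_separate_morphisms[OF M assms(3-5)]
  show "\<exists>P \<in> zn_points n. \<exists>s \<in> zn_hom n P M. zn_comp P M N' \<phi> s \<noteq> zn_comp P M N' \<psi> s" by blast
qed

end
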